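(* Let $\{X(t),t\ge 0\}$ be a centered Gaussian process with almost surely continuous sample paths, $X(0)=0$ and stationary increments, and let $\sigma^2(t)=\mathrm{Var}(X(t))$. Suppose that $\sigma^2(\cdot)$ is differentiable, strictly increasing and convex, and write $V'(t)$ for the derivative of $\sigma^2(t)$. Let $c>0$. Then for any positive constants $S,T$, $$\mathcal{P}_S(u,T)\ \ge\ C_{c,\Delta}\,\frac{\sigma^2(S)}{u}\,\Psi\!\left(\frac{u+cS}{\sigma(S)}\right)(1+o(1)),\qquad u\to\infty,$$ where $\Delta=\sigma^2(S+T)-\sigma^2(S)$ and $$C_{c,\Delta}=2\varphi\!\left(\frac{c\sqrt{\Delta}}{V'(S)}\right)\frac{1}{\sqrt{\Delta}}-2\frac{c}{V'(S)}\Psi\!\left(\frac{c\sqrt{\Delta}}{V'(S)}\right).$$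
   Context: For $u\ge 0$ and premium rate $c>0$ the risk process is $R_u(t)=u+ct-X(t)$, $t\ge 0$. For a constant $T>0$, the probability of Parisian ruin over $[0,S]$ is $$\mathcal{P}_S(u,T)=\mathbb{P}\Big\{\inf_{t\in[0,S]}\sup_{s\in[t,t+T]}R_u(s)<0\Big\}.$$ $\varphi$ denotes the density and $\Psi$ the tail distribution function (i.e. $\Psi(x)=\mathbb{P}\{\mathcal N>x\}$) of a standard normal $N(0,1)$ random variable $\mathcal N$. The asymptotic inequality $f(u)\ge g(u)(1+o(1))$ with $g>0$ means $\liminf_{u\to\infty}f(u)/g(u)\ge 1$. *)

theory Defs
  imports "HOL-Probability.Probability"
begin

(* Degenerate (almost surely constant) variables count as Gaussian; the library's
   normal_density does not cover variance 0. *)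
definition gaussian_rv :: "'a measure \<Rightarrow> ('a \<Rightarrow> real) \<Rightarrow> bool" where
  "gaussian_rv M Y \<longleftrightarrow> Y \<in> borel_measurable M \<and>
     ((\<exists>\<mu>. AE \<omega> in M. Y \<omega> = \<mu>) \<or>
      (\<exists>\<mu> s. 0 < s \<and> distributed M lborel Y (\<lambda>x. ennreal (normal_density \<mu> s x))))"

(* Processes are indexed by t \<ge> 0; values X t at t < 0 are never used. *)
definition gaussian_process :: "'a measure \<Rightarrow> (real \<Rightarrow> 'a \<Rightarrow> real) \<Rightarrow> bool" where
  "gaussian_process M X \<longleftrightarrow>
     (\<forall>J a. finite J \<and> J \<subseteq> {0..} \<longrightarrow> gaussian_rv M (\<lambda>\<omega>. \<Sum>t\<in>J. a t * X t \<omega>))"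

definition centered :: "'a measure \<Rightarrow> (real \<Rightarrow> 'a \<Rightarrow> real) \<Rightarrow> bool" where
  "centered M X \<longleftrightarrow> (\<forall>t\<ge>0. integrable M (X t) \<and> prob_space.expectation M (X t) = 0)"

definition continuous_paths_AE :: "'a measure \<Rightarrow> (real \<Rightarrow> 'a \<Rightarrow> real) \<Rightarrow> bool" where
  "continuous_paths_AE M X \<longleftrightarrow> (AE \<omega> in M. continuous_on {0..} (\<lambda>t. X t \<omega>))"

(* For every h \<ge> 0 the processes X(h + t) - X(h) and X(t) - X(0) have the same
   finite-dimensional distributions. *)
definition stationary_increments :: "'a measure \<Rightarrow> (real \<Rightarrow> 'a \<Rightarrow> real) \<Rightarrow> bool" where
  "stationary_increments M X \<longleftrightarrow>
     (\<forall>h\<ge>0. \<forall>J. finite J \<and> J \<subseteq> {0..} \<longrightarrow>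
        distr M (PiM J (\<lambda>_. borel)) (\<lambda>\<omega>. \<lambda>t\<in>J. X (h + t) \<omega> - X h \<omega>) =
        distr M (PiM J (\<lambda>_. borel)) (\<lambda>\<omega>. \<lambda>t\<in>J. X t \<omega> - X 0 \<omega>))"

definition var_fun :: "'a measure \<Rightarrow> (real \<Rightarrow> 'a \<Rightarrow> real) \<Rightarrow> real \<Rightarrow> real" where
  "var_fun M X t = prob_space.variance M (X t)"

definition risk_process :: "(real \<Rightarrow> 'a \<Rightarrow> real) \<Rightarrow> real \<Rightarrow> real \<Rightarrow> real \<Rightarrow> 'a \<Rightarrow> real" where
  "risk_process X c u t \<omega> = u + c * t - X t \<omega>"

(* The paths are only almost surely continuous, so the ruin event agrees with a
   measurable set only up to a null set; hence the completion of M. *)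
definition parisian_ruin_prob ::
  "'a measure \<Rightarrow> (real \<Rightarrow> 'a \<Rightarrow> real) \<Rightarrow> real \<Rightarrow> real \<Rightarrow> real \<Rightarrow> real \<Rightarrow> real" where
  "parisian_ruin_prob M X c S u T =
     measure (completion M)
       {\<omega> \<in> space M. (INF t\<in>{0..S}. SUP s\<in>{t..t+T}. risk_process X c u s \<omega>) < 0}"

definition normal_tail :: "real \<Rightarrow> real" where
  "normal_tail x = measure (density lborel (\<lambda>y. ennreal (std_normal_density y))) {x<..}"

(* The argument v stands for V'(S). *)
definition ruin_const :: "real \<Rightarrow> real \<Rightarrow> real \<Rightarrow> real" where
  "ruin_const c \<Delta> v =
     2 * std_normal_density (c * sqrt \<Delta> / v) * (1 / sqrt \<Delta>)
     - 2 * (c / v) * normal_tail (c * sqrt \<Delta> / v)"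

(* f(u) \<ge> g(u) (1 + o(1)) as u tends to infinity *)
definition asymp_ge :: "(real \<Rightarrow> real) \<Rightarrow> (real \<Rightarrow> real) \<Rightarrow> bool" where
  "asymp_ge f g \<longleftrightarrow> Liminf at_top (\<lambda>u. ereal (f u / g u)) \<ge> 1"

end

theory Submission
  imports Defs "HOL-Real_Asymp.Real_Asymp"
begin

text \<open>Only the starting time \<open>t = S\<close> of the Parisian excursion is kept, so that it suffices to bound the
  probability of \<open>X s > u + c s\<close> on \<open>{S..S+T}\<close> from below. Convexity of the variance function \<open>V\<close> makes
  the covariance of \<open>X\<close> dominate that of the time-changed Brownian motion \<open>W (V s)\<close>, which has the same
  variances; by Slepian's inequality on dyadic grids, \<open>X\<close> may be replaced by a Gaussian random walk. By
  convexity again, \<open>c (s - S) \<le> k (V s - V S)\<close> with \<open>k = c / V' S\<close>, so the walk only has to stay above a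
  line of slope \<open>k\<close> during the time \<open>\<Delta> = V (S+T) - V S\<close>. The probability that Brownian motion does so from
  height \<open>z\<close> is explicit, and its derivative at \<open>z = 0\<close> is the constant of the theorem; integrating over
  the overshoot of \<open>X S\<close> above \<open>u + c S\<close>, which is of order \<open>1 / u\<close>, gives the asymptotics.

  Slepian's inequality is proved by interpolating between the two Gaussian vectors. For products of
  trigonometric polynomials the expectation is a finite sum of values of the characteristic function, so
  no integration by parts is needed; \<open>cos (z / sqrt n) ^ (2 * n + 1)\<close> tends to \<open>exp (- z\<^sup>2)\<close>, and hence
  increasing test functions arise as bounded limits of trigonometric polynomials.\<close>

section \<open>Trigonometric polynomials\<close>

text \<open>Slepian's inequality concerns finitely many coordinates with equal variances; this
  dictates the clock \<open>V\<close>, under which Brownian motion has variance \<open>V s\<close>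
  at time \<open>s\<close> and covariance \<open>V (min s t)\<close>. The slope
  \<open>k = c / V' S\<close> is the smallest for which the line in this clock dominates
  \<open>c * (s - S)\<close> just after \<open>S\<close>. No Brownian motion is constructed: its
  survival probability enters as a signed Gaussian expectation that is nonpositive below the line,
  and this yields the same lower bound for the walk on every grid, so the mesh may tend to 0. The
  constant is (2 / \<Delta>) E max(0, Z) with Z normal of mean - k \<Delta> and variance \<Delta>,
  the first-order coefficient of survival in the starting height. It is multiplied by
  \<open>V S / u\<close> because the overshoot of \<open>X S\<close>, given that it occurs, is
  nearly exponential with rate \<open>u / V S\<close>. Slepian's inequality leaves weak inequalities
  where ruin demands strict ones; a slack \<eta> in the level bridges this and is removed by
  continuity.\<close>

definition trig_poly :: "(real \<Rightarrow> real) \<Rightarrow> bool" where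
  "trig_poly g \<longleftrightarrow> (\<exists>K c. finite K \<and> (\<forall>z. complex_of_real (g z) = (\<Sum>k\<in>K. c k * cis (k * z))))"

lemma trig_poly_const: "trig_poly (\<lambda>_. a)"
  unfolding trig_poly_def by (intro exI[of _ "{0}"] exI[of _ "\<lambda>_. complex_of_real a"]) simp

lemma trig_poly_sin: "trig_poly (\<lambda>z. sin (w * z + b))"
\<comment> \<open>Euler's formula uses the frequencies \<open>w\<close> and \<open>- w\<close>,
  which must be distinct to index two summands.\<close>
proof (cases "w = 0")
  case True
  then show ?thesis using trig_poly_const[of "sin b"] by simp
next
  case False
  define d where "d k = (if k = w then - (\<i> / 2) * cis b else (\<i> / 2) * cis (- b))" for k
  have "complex_of_real (sin (w * z + b)) = (\<Sum>k\<in>{w, -w}. d k * cis (k * z))" for z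
    using False by (simp add: complex_eq_iff cos_add sin_add d_def) (simp add: field_simps)
  then have "finite {w, -w} \<and> (\<forall>z. complex_of_real (sin (w * z + b)) = (\<Sum>k\<in>{w, -w}. d k * cis (k * z)))"
    by simp
  then show ?thesis unfolding trig_poly_def by (intro exI)
qed

text \<open>In \<open>trig_poly\<close> each frequency is its own index, so that a product over
  coordinates expands over frequency vectors in \<open>PiE I K\<close>. Sums and products create
  repeated frequencies; collecting the terms along the fibers of \<open>f\<close> restores the
  format.\<close>

lemma trig_poly_group:
  fixes d :: "'b \<Rightarrow> complex" and f :: "'b \<Rightarrow> real"
  assumes "finite J" "\<And>z. complex_of_real (g z) = (\<Sum>j\<in>J. d j * cis (f j * z))"
  shows "trig_poly g"
proof -
  have "complex_of_real (g z) = (\<Sum>k\<in>f ` J. (\<Sum>j\<in>{j\<in>J. f j = k}. d j) * cis (k * z))" for z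
  proof -
    have "(\<Sum>k\<in>f ` J. (\<Sum>j\<in>{j\<in>J. f j = k}. d j) * cis (k * z))
       = (\<Sum>k\<in>f ` J. (\<Sum>j\<in>{j\<in>J. f j = k}. d j * cis (f j * z)))"
      by (intro sum.cong refl) (simp add: sum_distrib_right)
    also have "\<dots> = (\<Sum>j\<in>J. d j * cis (f j * z))"
      by (rule sum.group) (use assms(1) in auto)
    finally show ?thesis using assms(2) by simp
  qed
  then show ?thesis unfolding trig_poly_def
    using assms(1) by (intro exI[of _ "f ` J"] exI[of _ "\<lambda>k. \<Sum>j\<in>{j\<in>J. f j = k}. d j"]) simp
qed

lemma trig_poly_add:
  assumes "trig_poly g" "trig_poly h" shows "trig_poly (\<lambda>z. g z + h z)"
proof -
  obtain K c where 1: "finite K" "\<And>z. complex_of_real (g z) = (\<Sum>k\<in>K. c k * cis (k * z))"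
    using assms(1) unfolding trig_poly_def by auto
  obtain L d where 2: "finite L" "\<And>z. complex_of_real (h z) = (\<Sum>k\<in>L. d k * cis (k * z))"
    using assms(2) unfolding trig_poly_def by auto
  show ?thesis
    by (rule trig_poly_group[where J="K <+> L" and d="case_sum c d" and f="case_sum id id"])
      (simp_all add: 1 2 sum.Plus)
qed

lemma trig_poly_mult:
  assumes "trig_poly g" "trig_poly h" shows "trig_poly (\<lambda>z. g z * h z)"
proof -
  obtain K c where 1: "finite K" "\<And>z. complex_of_real (g z) = (\<Sum>k\<in>K. c k * cis (k * z))"
    using assms(1) unfolding trig_poly_def by auto
  obtain L d where 2: "finite L" "\<And>z. complex_of_real (h z) = (\<Sum>k\<in>L. d k * cis (k * z))"
    using assms(2) unfolding trig_poly_def by auto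
  have cis_prod: "a * cis (x * z) * (b * cis (y * z)) = a * b * cis ((x + y) * z)" for a b x y z
    by (simp add: distrib_right flip: cis_mult)
  show ?thesis
    by (rule trig_poly_group[where J="K \<times> L" and d="\<lambda>(k,l). c k * d l" and f="\<lambda>(k,l). k + l"])
      (simp_all add: 1 2 sum_product sum.cartesian_product split_beta cis_prod)
qed

lemma trig_poly_power: "trig_poly g \<Longrightarrow> trig_poly (\<lambda>z. g z ^ n)"
  by (induction n) (simp_all add: trig_poly_const trig_poly_mult)

lemma trig_poly_sum: "(\<And>j. j \<in> J \<Longrightarrow> trig_poly (g j)) \<Longrightarrow> trig_poly (\<lambda>z. \<Sum>j\<in>J. g j z)"
  by (induction J rule: infinite_finite_induct) (simp_all add: trig_poly_const trig_poly_add)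

text \<open>Differentiation keeps the frequency set and only changes coefficients, so test functions
  and their derivatives can be mixed in one product over the same \<open>K\<close>.\<close>

lemma trig_poly_deriv_expansion:
  assumes "finite K" "\<And>z. complex_of_real (g z) = (\<Sum>k\<in>K. c k * cis (k * z))"
    and "\<And>z. (g has_real_derivative g' z) (at z)"
  shows "complex_of_real (g' z) = (\<Sum>k\<in>K. c k * (\<i> * of_real k) * cis (k * z))"
proof -
  have "((\<lambda>z. complex_of_real (g z)) has_vector_derivative complex_of_real (g' z)) (at z)"
    using assms(3)[of z] by (intro has_vector_derivative_of_real) (simp add: has_real_derivative_iff_has_vector_derivative)
  moreover have "((\<lambda>z. \<Sum>k\<in>K. c k * cis (k * z)) has_vector_derivative
     (\<Sum>k\<in>K. c k * (\<i> * of_real k) * cis (k * z))) (at z)"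
  proof (intro has_vector_derivative_sum)
    fix k assume "k \<in> K"
    have "((\<lambda>z. c k * exp (\<i> * of_real k * z)) has_field_derivative
      c k * (\<i> * of_real k) * exp (\<i> * of_real k * of_real z)) (at (of_real z))"
      by (auto intro!: derivative_eq_intros)
    from has_vector_derivative_real_field[OF this]
    show "((\<lambda>z. c k * cis (k * z)) has_vector_derivative c k * (\<i> * of_real k) * cis (k * z)) (at z)"
      by (simp add: cis_conv_exp mult.assoc)
  qed
  ultimately show ?thesis
    using vector_derivative_unique_at unfolding assms(2) by blast
qed

section \<open>Gaussian interpolation\<close>

lemma cis_sum: "cis (\<Sum>i\<in>I. f i) = (\<Prod>i\<in>I. cis (f i))"
  by (induction I rule: infinite_finite_induct) (simp_all flip: cis_mult)

lemma borel_measurable_cis [measurable]: "cis \<in> borel_measurable borel"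
  unfolding cis_conv_exp by measurable

text \<open>Gaussianity is assumed only through characteristic functions of linear combinations,
  which covers degenerate covariances, where no density exists. \<open>diag\<close> and
  \<open>off_diag\<close> are the hypotheses of Slepian's inequality.\<close>

locale gaussian_comparison = M: prob_space M + N: prob_space N
  for M :: "'a measure" and N :: "'b measure" +
  fixes I :: "'i set" and X :: "'i \<Rightarrow> 'a \<Rightarrow> real" and Y :: "'i \<Rightarrow> 'b \<Rightarrow> real"
    and CX CY :: "'i \<Rightarrow> 'i \<Rightarrow> real"
  assumes finite_I: "finite I"
    and X_meas [measurable]: "\<And>i. X i \<in> borel_measurable M"
    and Y_meas [measurable]: "\<And>i. Y i \<in> borel_measurable N"
    and char_X: "\<And>a. (\<integral>\<omega>. cis (\<Sum>i\<in>I. a i * X i \<omega>) \<partial>M)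
       = of_real (exp (- (\<Sum>i\<in>I. \<Sum>j\<in>I. a i * a j * CX i j) / 2))"
    and char_Y: "\<And>a. (\<integral>\<omega>. cis (\<Sum>i\<in>I. a i * Y i \<omega>) \<partial>N)
       = of_real (exp (- (\<Sum>i\<in>I. \<Sum>j\<in>I. a i * a j * CY i j) / 2))"
    and diag: "\<And>i. i \<in> I \<Longrightarrow> CX i i = CY i i"
    and off_diag: "\<And>i j. i \<in> I \<Longrightarrow> j \<in> I \<Longrightarrow> i \<noteq> j \<Longrightarrow> CY i j \<le> CX i j"
begin

sublocale P: pair_prob_space M N ..

text \<open>The product measure makes the two families independent, and the square roots make the
  covariance affine in \<theta>, from \<open>CY\<close> at 0 to \<open>CX\<close> at 1.\<close>

definition interpolant :: "real \<Rightarrow> 'i \<Rightarrow> 'a \<times> 'b \<Rightarrow> real" where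
  "interpolant \<theta> i \<omega> = sqrt \<theta> * X i (fst \<omega>) + sqrt (1 - \<theta>) * Y i (snd \<omega>)"

lemma interpolant_measurable [measurable]: "interpolant \<theta> i \<in> borel_measurable (M \<Otimes>\<^sub>M N)"
  unfolding interpolant_def by measurable

definition interpolated_form :: "real \<Rightarrow> ('i \<Rightarrow> real) \<Rightarrow> real" where
  "interpolated_form \<theta> a = (\<Sum>i\<in>I. \<Sum>j\<in>I. a i * a j * (\<theta> * CX i j + (1 - \<theta>) * CY i j))"

lemma char_interpolant:
  assumes "0 \<le> \<theta>" "\<theta> \<le> 1"
  shows "(\<integral>\<omega>. cis (\<Sum>i\<in>I. a i * interpolant \<theta> i \<omega>) \<partial>(M \<Otimes>\<^sub>M N)) = of_real (exp (- interpolated_form \<theta> a / 2))"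
proof -
  let ?s = "sqrt \<theta>" and ?t = "sqrt (1 - \<theta>)"
  have sq: "?s * ?s = \<theta>" "?t * ?t = 1 - \<theta>" using assms by auto
  have split: "cis (\<Sum>i\<in>I. a i * interpolant \<theta> i (x, y))
      = cis (\<Sum>i\<in>I. (?s * a i) * X i x) * cis (\<Sum>i\<in>I. (?t * a i) * Y i y)" for x y
    unfolding interpolant_def cis_mult by (simp add: sum.distrib algebra_simps)
  have "integrable (M \<Otimes>\<^sub>M N) (\<lambda>\<omega>. cis (\<Sum>i\<in>I. a i * interpolant \<theta> i \<omega>))"
    by (rule P.integrable_const_bound[where B=1]) auto
  from P.integral_fst'[OF this, symmetric]
  have "(\<integral>\<omega>. cis (\<Sum>i\<in>I. a i * interpolant \<theta> i \<omega>) \<partial>(M \<Otimes>\<^sub>M N))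
     = (\<integral>x. (\<integral>y. cis (\<Sum>i\<in>I. (?s * a i) * X i x) * cis (\<Sum>i\<in>I. (?t * a i) * Y i y) \<partial>N) \<partial>M)"
    unfolding split .
  also have "\<dots> = of_real (exp (- (\<Sum>i\<in>I. \<Sum>j\<in>I. (?s * a i) * (?s * a j) * CX i j) / 2))
    * of_real (exp (- (\<Sum>i\<in>I. \<Sum>j\<in>I. (?t * a i) * (?t * a j) * CY i j) / 2))"
    unfolding integral_mult_right_zero integral_mult_left_zero char_X char_Y ..
  also have "\<dots> = of_real (exp (- ((\<Sum>i\<in>I. \<Sum>j\<in>I. (?s * a i) * (?s * a j) * CX i j)
      + (\<Sum>i\<in>I. \<Sum>j\<in>I. (?t * a i) * (?t * a j) * CY i j)) / 2))"
    unfolding of_real_mult[symmetric] exp_add[symmetric] by (simp add: add_divide_distrib)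
  also have "(\<Sum>i\<in>I. \<Sum>j\<in>I. (?s * a i) * (?s * a j) * CX i j)
      + (\<Sum>i\<in>I. \<Sum>j\<in>I. (?t * a i) * (?t * a j) * CY i j) = interpolated_form \<theta> a"
  proof -
    have 1: "(?s * a i) * (?s * a j) * CX i j = a i * a j * (\<theta> * CX i j)" for i j
    proof -
      have "(?s * a i) * (?s * a j) * CX i j = a i * a j * ((?s * ?s) * CX i j)"
        by (simp only: mult_ac)
      then show ?thesis unfolding sq by (simp add: mult.assoc)
    qed
    have 2: "(?t * a i) * (?t * a j) * CY i j = a i * a j * ((1 - \<theta>) * CY i j)" for i j
    proof -
      have "(?t * a i) * (?t * a j) * CY i j = a i * a j * ((?t * ?t) * CY i j)"
        by (simp only: mult_ac)
      then show ?thesis unfolding sq by (simp add: mult.assoc)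
    qed
    show ?thesis
      unfolding 1 2 interpolated_form_def sum.distrib[symmetric] distrib_left ..
  qed
  finally show ?thesis .
qed

text \<open>The closed form of an expectation, see \<open>expectation_trig\<close>. As a finite sum
  of exponentials of affine functions of \<theta> it is differentiable at 0 and 1 too, where the
  square roots in \<open>interpolant\<close> are not.\<close>

definition trig_expectation :: "('i \<Rightarrow> real set) \<Rightarrow> ('i \<Rightarrow> real \<Rightarrow> complex) \<Rightarrow> real \<Rightarrow> complex" where
  "trig_expectation K c \<theta> = (\<Sum>a\<in>PiE I K. (\<Prod>i\<in>I. c i (a i)) * of_real (exp (- interpolated_form \<theta> a / 2)))"

lemma expectation_trig:
  assumes "0 \<le> \<theta>" "\<theta> \<le> 1" and K: "\<And>i. i \<in> I \<Longrightarrow> finite (K i)"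
  shows "(\<integral>\<omega>. (\<Prod>i\<in>I. \<Sum>k\<in>K i. c i k * cis (k * interpolant \<theta> i \<omega>)) \<partial>(M \<Otimes>\<^sub>M N)) = trig_expectation K c \<theta>"
proof -
  have int: "integrable (M \<Otimes>\<^sub>M N) (\<lambda>\<omega>. cis (\<Sum>i\<in>I. a i * interpolant \<theta> i \<omega>))" for a
    by (rule P.integrable_const_bound[where B=1]) auto
  have "(\<Prod>i\<in>I. \<Sum>k\<in>K i. c i k * cis (k * interpolant \<theta> i \<omega>))
     = (\<Sum>a\<in>PiE I K. (\<Prod>i\<in>I. c i (a i)) * cis (\<Sum>i\<in>I. a i * interpolant \<theta> i \<omega>))" for \<omega>
    by (simp add: prod_sum_PiE finite_I K prod.distrib cis_sum)
  then show ?thesis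
    by (simp add: trig_expectation_def int char_interpolant assms)
qed

text \<open>Differentiating the Gaussian factor brings down \<open>- a i * a j / 2\<close>, which is exactly what
  differentiating the test functions with indices \<open>i\<close> and \<open>j\<close> produces.\<close>

lemma trig_expectation_deriv:
  assumes K: "\<And>i. i \<in> I \<Longrightarrow> finite (K i)"
  shows "(trig_expectation K c has_vector_derivative
    (\<Sum>i\<in>I. \<Sum>j\<in>I - {i}. of_real ((CX i j - CY i j) / 2) *
      trig_expectation K (\<lambda>l k. c l k * (if l \<in> {i, j} then \<i> * of_real k else 1)) \<theta>)) (at \<theta> within A)"
proof -
  have Qd: "((\<lambda>\<theta>. interpolated_form \<theta> a) has_real_derivative
      (\<Sum>i\<in>I. \<Sum>j\<in>I. a i * a j * (CX i j - CY i j))) (at \<theta> within A)" for a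
    unfolding interpolated_form_def by (auto intro!: derivative_eq_intros DERIV_sum)
  have "((\<lambda>\<theta>. exp (- interpolated_form \<theta> a / 2)) has_real_derivative
     - exp (- interpolated_form \<theta> a / 2) * (\<Sum>i\<in>I. \<Sum>j\<in>I. a i * a j * (CX i j - CY i j)) / 2) (at \<theta> within A)" for a
    by (rule derivative_eq_intros Qd refl | simp)+
  then have d: "((\<lambda>\<theta>. of_real (exp (- interpolated_form \<theta> a / 2))) has_vector_derivative
     complex_of_real (- exp (- interpolated_form \<theta> a / 2) * (\<Sum>i\<in>I. \<Sum>j\<in>I. a i * a j * (CX i j - CY i j)) / 2)) (at \<theta> within A)" for a
    by (intro has_vector_derivative_of_real) (simp add: has_real_derivative_iff_has_vector_derivative)
  have "(trig_expectation K c has_vector_derivative (\<Sum>a\<in>PiE I K. (\<Prod>i\<in>I. c i (a i)) *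
     complex_of_real (- exp (- interpolated_form \<theta> a / 2) * (\<Sum>i\<in>I. \<Sum>j\<in>I. a i * a j * (CX i j - CY i j)) / 2))) (at \<theta> within A)"
    unfolding trig_expectation_def by (intro has_vector_derivative_sum has_vector_derivative_mult_right d)
  also have "(\<Sum>a\<in>PiE I K. (\<Prod>i\<in>I. c i (a i)) *
     complex_of_real (- exp (- interpolated_form \<theta> a / 2) * (\<Sum>i\<in>I. \<Sum>j\<in>I. a i * a j * (CX i j - CY i j)) / 2))
    = (\<Sum>i\<in>I. \<Sum>j\<in>I - {i}. of_real ((CX i j - CY i j) / 2) *
      trig_expectation K (\<lambda>l k. c l k * (if l \<in> {i, j} then \<i> * of_real k else 1)) \<theta>)"
  proof -
    have pr: "(\<Prod>l\<in>I. c l (a l) * (if l \<in> {i, j} then \<i> * of_real (a l) else 1))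
      = - of_real (a i * a j) * (\<Prod>l\<in>I. c l (a l))" if "i \<in> I" "j \<in> I - {i}" for a :: "'i \<Rightarrow> real" and i j
    proof -
      have "(\<Prod>l\<in>I. if l \<in> {i, j} then \<i> * complex_of_real (a l) else 1)
        = (\<Prod>l\<in>{i, j}. \<i> * complex_of_real (a l))"
        using that finite_I by (intro prod.mono_neutral_cong_right) auto
      also have "\<dots> = (\<i> * of_real (a i)) * (\<i> * of_real (a j))" using that by auto
      also have "\<dots> = - of_real (a i * a j)" by (simp add: complex_eq_iff)
      finally show ?thesis by (simp only: prod.distrib mult.commute)
    qed
    \<comment> \<open>Equal variances remove the diagonal; a term with \<open>i = j\<close> would
      call for the second derivative of one test function.\<close>
    have "(\<Sum>i\<in>I. \<Sum>j\<in>I. a i * a j * (CX i j - CY i j))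
      = (\<Sum>i\<in>I. \<Sum>j\<in>I - {i}. a i * a j * (CX i j - CY i j))" for a
      using finite_I diag by (intro sum.cong refl sum.mono_neutral_right) auto
    then have "(\<Sum>a\<in>PiE I K. (\<Prod>i\<in>I. c i (a i)) *
     complex_of_real (- exp (- interpolated_form \<theta> a / 2) * (\<Sum>i\<in>I. \<Sum>j\<in>I. a i * a j * (CX i j - CY i j)) / 2))
     = (\<Sum>a\<in>PiE I K. \<Sum>i\<in>I. \<Sum>j\<in>I - {i}. of_real ((CX i j - CY i j) / 2) *
        (- of_real (a i * a j) * (\<Prod>l\<in>I. c l (a l)) * of_real (exp (- interpolated_form \<theta> a / 2))))"
      by (simp add: sum_distrib_left sum_divide_distrib sum_negf mult_ac flip: sum_distrib_right)
    also have "\<dots> = (\<Sum>i\<in>I. \<Sum>j\<in>I - {i}. \<Sum>a\<in>PiE I K. of_real ((CX i j - CY i j) / 2) *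
        (- of_real (a i * a j) * (\<Prod>l\<in>I. c l (a l)) * of_real (exp (- interpolated_form \<theta> a / 2))))"
      by (subst sum.swap, intro sum.cong refl, rule sum.swap)
    also have "\<dots> = (\<Sum>i\<in>I. \<Sum>j\<in>I - {i}. of_real ((CX i j - CY i j) / 2) *
      trig_expectation K (\<lambda>l k. c l k * (if l \<in> {i, j} then \<i> * of_real k else 1)) \<theta>)"
      unfolding trig_expectation_def sum_distrib_left
      by (intro sum.cong refl) (simp only: pr)
    finally show ?thesis .
  qed
  finally show ?thesis .
qed

lemma expectation_trig_poly:
  assumes "0 \<le> \<theta>" "\<theta> \<le> 1" and K: "\<And>i. i \<in> I \<Longrightarrow> finite (K i)"
    and g: "\<And>i z. i \<in> I \<Longrightarrow> complex_of_real (g i z) = (\<Sum>k\<in>K i. c i k * cis (k * z))"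
  shows "of_real (\<integral>\<omega>. (\<Prod>i\<in>I. g i (interpolant \<theta> i \<omega>)) \<partial>(M \<Otimes>\<^sub>M N)) = trig_expectation K c \<theta>"
proof -
  have "of_real (\<integral>\<omega>. (\<Prod>i\<in>I. g i (interpolant \<theta> i \<omega>)) \<partial>(M \<Otimes>\<^sub>M N))
     = (\<integral>\<omega>. (\<Prod>i\<in>I. complex_of_real (g i (interpolant \<theta> i \<omega>))) \<partial>(M \<Otimes>\<^sub>M N))"
    unfolding integral_complex_of_real[symmetric] of_real_prod ..
  also have "\<dots> = (\<integral>\<omega>. (\<Prod>i\<in>I. \<Sum>k\<in>K i. c i k * cis (k * interpolant \<theta> i \<omega>)) \<partial>(M \<Otimes>\<^sub>M N))"
    by (simp add: g cong: prod.cong)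
  finally show ?thesis using expectation_trig[OF assms(1-3)] by simp
qed

text \<open>Plackett's identity, integrated over \<theta>. In this form it contains only integrals
  of the test functions and their first derivatives, so it passes to bounded pointwise
  limits.\<close>

lemma interpolation:
  assumes trig: "\<And>i. i \<in> I \<Longrightarrow> trig_poly (g i)"
    and deriv: "\<And>i z. i \<in> I \<Longrightarrow> (g i has_real_derivative g' i z) (at z)"
  shows "((\<lambda>\<theta>. \<Sum>i\<in>I. \<Sum>j\<in>I - {i}. (CX i j - CY i j) / 2 *
       (\<integral>\<omega>. (\<Prod>l\<in>I. (if l \<in> {i, j} then g' l else g l) (interpolant \<theta> l \<omega>)) \<partial>(M \<Otimes>\<^sub>M N)))
     has_integral ((\<integral>\<omega>. (\<Prod>i\<in>I. g i (interpolant 1 i \<omega>)) \<partial>(M \<Otimes>\<^sub>M N))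
       - (\<integral>\<omega>. (\<Prod>i\<in>I. g i (interpolant 0 i \<omega>)) \<partial>(M \<Otimes>\<^sub>M N)))) {0..1}"
proof -
  from trig obtain K c where K: "\<And>i. i \<in> I \<Longrightarrow> finite (K i)"
    and g: "\<And>i z. i \<in> I \<Longrightarrow> complex_of_real (g i z) = (\<Sum>k\<in>K i. c i k * cis (k * z))"
    unfolding trig_poly_def by metis
  have g': "complex_of_real (g' i z) = (\<Sum>k\<in>K i. (c i k * (\<i> * of_real k)) * cis (k * z))" if "i \<in> I" for i z
    by (rule trig_poly_deriv_expansion[OF K g deriv]) fact+
  have gg: "complex_of_real ((if l \<in> {i, j} then g' l else g l) z)
     = (\<Sum>k\<in>K l. (c l k * (if l \<in> {i, j} then \<i> * of_real k else 1)) * cis (k * z))" if "l \<in> I" for i j l z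
    using g'[OF that] g[OF that] by simp
  let ?D = "\<lambda>\<theta>. \<Sum>i\<in>I. \<Sum>j\<in>I - {i}. of_real ((CX i j - CY i j) / 2) *
      trig_expectation K (\<lambda>l k. c l k * (if l \<in> {i, j} then \<i> * of_real k else 1)) \<theta>"
  have "(?D has_integral trig_expectation K c 1 - trig_expectation K c 0) {0..1}"
    by (intro fundamental_theorem_of_calculus trig_expectation_deriv K) auto
  from has_integral_linear[OF this bounded_linear_Re]
  have I: "((\<lambda>\<theta>. Re (?D \<theta>)) has_integral Re (trig_expectation K c 1 - trig_expectation K c 0)) {0..1}"
    by (simp add: o_def)
  have eq: "Re (?D \<theta>) = (\<Sum>i\<in>I. \<Sum>j\<in>I - {i}. (CX i j - CY i j) / 2 *
       (\<integral>\<omega>. (\<Prod>l\<in>I. (if l \<in> {i, j} then g' l else g l) (interpolant \<theta> l \<omega>)) \<partial>(M \<Otimes>\<^sub>M N)))"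
    if "\<theta> \<in> {0..1}" for \<theta>
    using that
    by (subst expectation_trig_poly[OF _ _ K gg, symmetric]) auto
  have eq2: "Re (trig_expectation K c \<theta>) = (\<integral>\<omega>. (\<Prod>i\<in>I. g i (interpolant \<theta> i \<omega>)) \<partial>(M \<Otimes>\<^sub>M N))" if "\<theta> \<in> {0..1}" for \<theta>
    using that by (subst expectation_trig_poly[OF _ _ K g, symmetric]) auto
  from has_integral_eq[OF eq I] show ?thesis
    by (simp add: eq2)
qed

text \<open>A nonconstant trigonometric polynomial is never monotone, so no sign is available before
  the limit. The integrated identity passes to the limit by dominated convergence; there
  \<open>h\<close>, \<open>h'\<close> and the off-diagonal \<open>CX i j - CY i j\<close> are
  nonnegative, hence so is the difference of the two expectations.\<close>

lemma expectation_limit_mono: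
  fixes g g' :: "nat \<Rightarrow> 'i \<Rightarrow> real \<Rightarrow> real"
  assumes trig: "\<And>n i. i \<in> I \<Longrightarrow> trig_poly (g n i)"
    and deriv: "\<And>n i z. i \<in> I \<Longrightarrow> (g n i has_real_derivative g' n i z) (at z)"
    and bound: "\<And>n i z. i \<in> I \<Longrightarrow> \<bar>g n i z\<bar> \<le> B" "\<And>n i z. i \<in> I \<Longrightarrow> \<bar>g' n i z\<bar> \<le> B"
    and meas: "\<And>n i. i \<in> I \<Longrightarrow> g' n i \<in> borel_measurable borel"
    and lim: "\<And>i z. i \<in> I \<Longrightarrow> (\<lambda>n. g n i z) \<longlonglongrightarrow> h i z" "\<And>i z. i \<in> I \<Longrightarrow> (\<lambda>n. g' n i z) \<longlonglongrightarrow> h' i z"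
    and nonneg: "\<And>i z. i \<in> I \<Longrightarrow> 0 \<le> h i z" "\<And>i z. i \<in> I \<Longrightarrow> 0 \<le> h' i z"
  shows "(\<integral>\<omega>. (\<Prod>i\<in>I. h i (Y i \<omega>)) \<partial>N) \<le> (\<integral>\<omega>. (\<Prod>i\<in>I. h i (X i \<omega>)) \<partial>M)"
proof -
  have [measurable]: "g n i \<in> borel_measurable borel" if "i \<in> I" for n i
    using deriv[OF that] by (intro borel_measurable_continuous_onI) (meson DERIV_isCont continuous_at_imp_continuous_on)
  note meas [measurable]
  have h_meas [measurable]: "h i \<in> borel_measurable borel" if "i \<in> I" for i
    by (rule borel_measurable_LIMSEQ_real[OF lim(1)]) (use that in auto)
  have h'_meas [measurable]: "h' i \<in> borel_measurable borel" if "i \<in> I" for i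
    by (rule borel_measurable_LIMSEQ_real[OF lim(2)]) (use that in auto)
  have prod_bound: "\<bar>\<Prod>l\<in>I. f l\<bar> \<le> B ^ card I" if "\<And>l. l \<in> I \<Longrightarrow> \<bar>f l\<bar> \<le> B" for f :: "'i \<Rightarrow> real"
    using prod_mono[of I "\<lambda>l. \<bar>f l\<bar>" "\<lambda>_. B"] that by (simp add: abs_prod)
  \<comment> \<open>\<open>S\<close> marks the coordinates whose test function is differentiated:
    the empty set at the endpoints of the interpolation, \<open>{i, j}\<close> in the
    integrand.\<close>
  define k where "k n S l = (if l \<in> S then g' n l else g n l)" for n S l
  define kk where "kk S l = (if l \<in> S then h' l else h l)" for S l
  have k_meas [measurable]: "k n S l \<in> borel_measurable borel" if "l \<in> I" for n S l
    using that by (simp add: k_def)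
  have kk_meas [measurable]: "kk S l \<in> borel_measurable borel" if "l \<in> I" for S l
    using that by (simp add: kk_def)
  have k_bound: "\<bar>k n S l z\<bar> \<le> B" if "l \<in> I" for n S l z
    using that bound by (simp add: k_def)
  have k_lim: "(\<lambda>n. k n S l z) \<longlonglongrightarrow> kk S l z" if "l \<in> I" for S l z
    using that lim by (simp add: k_def kk_def)
  let ?J = "\<lambda>n S \<theta>. \<integral>\<omega>. (\<Prod>l\<in>I. k n S l (interpolant \<theta> l \<omega>)) \<partial>(M \<Otimes>\<^sub>M N)"
  let ?JJ = "\<lambda>S \<theta>. \<integral>\<omega>. (\<Prod>l\<in>I. kk S l (interpolant \<theta> l \<omega>)) \<partial>(M \<Otimes>\<^sub>M N)"
  have J_lim: "(\<lambda>n. ?J n S \<theta>) \<longlonglongrightarrow> ?JJ S \<theta>" for S \<theta>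
    by (rule integral_dominated_convergence[where w="\<lambda>_. B ^ card I"])
       (auto intro!: prod_bound k_bound tendsto_prod k_lim)
  have J_bound: "\<bar>?J n S \<theta>\<bar> \<le> B ^ card I" for n S \<theta>
  proof -
    have b: "\<bar>\<Prod>l\<in>I. k n S l (interpolant \<theta> l \<omega>)\<bar> \<le> B ^ card I" for \<omega>
      by (intro prod_bound k_bound)
    have "integrable (M \<Otimes>\<^sub>M N) (\<lambda>\<omega>. \<Prod>l\<in>I. k n S l (interpolant \<theta> l \<omega>))"
      using b by (intro P.integrable_const_bound[where B="B ^ card I"]) auto
    then have "(\<integral>\<omega>. \<bar>\<Prod>l\<in>I. k n S l (interpolant \<theta> l \<omega>)\<bar> \<partial>(M \<Otimes>\<^sub>M N)) \<le> B ^ card I"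
      using b by (intro P.integral_le_const) auto
    then show ?thesis
      using integral_norm_bound[of "M \<Otimes>\<^sub>M N" "\<lambda>\<omega>. \<Prod>l\<in>I. k n S l (interpolant \<theta> l \<omega>)"]
      unfolding real_norm_def by (rule order_trans[rotated])
  qed
  have JJ_nonneg: "0 \<le> ?JJ S \<theta>" for S \<theta>
    by (intro integral_nonneg_AE AE_I2 prod_nonneg) (auto simp: kk_def nonneg)
  let ?d = "\<lambda>n. ?J n {} 1 - ?J n {} 0"
  define R where "R n \<theta> = (\<Sum>i\<in>I. \<Sum>j\<in>I - {i}. (CX i j - CY i j) / 2 * ?J n {i, j} \<theta>)" for n \<theta>
  define RR where "RR \<theta> = (\<Sum>i\<in>I. \<Sum>j\<in>I - {i}. (CX i j - CY i j) / 2 * ?JJ {i, j} \<theta>)" for \<theta>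
  have R_int: "(R n has_integral ?d n) {0..1}" for n
    using interpolation[of "g n" "g' n", OF trig deriv] unfolding R_def k_def by simp
  have R_bound: "norm (R n \<theta>) \<le> (\<Sum>i\<in>I. \<Sum>j\<in>I - {i}. (CX i j - CY i j) / 2 * B ^ card I)" for n \<theta>
    unfolding R_def real_norm_def
  proof (intro order_trans[OF sum_abs] sum_mono)
    fix i j assume "i \<in> I" "j \<in> I - {i}"
    then have "0 \<le> (CX i j - CY i j) / 2" using off_diag[of i j] by auto
    then show "\<bar>(CX i j - CY i j) / 2 * ?J n {i, j} \<theta>\<bar> \<le> (CX i j - CY i j) / 2 * B ^ card I"
      unfolding abs_mult using J_bound by (simp only: abs_of_nonneg mult_left_mono)
  qed
  have R_lim: "(\<lambda>n. R n \<theta>) \<longlonglongrightarrow> RR \<theta>" for \<theta>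
    unfolding R_def RR_def by (intro tendsto_sum tendsto_mult tendsto_const J_lim)
  define W where "W = (\<Sum>i\<in>I. \<Sum>j\<in>I - {i}. (CX i j - CY i j) / 2 * B ^ card I)"
  have RW: "norm (R n \<theta>) \<le> W" for n \<theta>
    using R_bound unfolding W_def .
  have dom: "RR integrable_on {0..1}" "(\<lambda>n. integral {0..1} (R n)) \<longlonglongrightarrow> integral {0..1} RR"
    using dominated_convergence[where h="\<lambda>_. W" and f=R,
        OF has_integral_integrable[OF R_int] integrable_const_ivl RW R_lim]
    by this
  note dom(2)
  moreover have "integral {0..1} (R n) = ?d n" for n
    using R_int by (rule integral_unique)
  ultimately have "(\<lambda>n. ?d n) \<longlonglongrightarrow> integral {0..1} RR"
    by simp
  moreover have "(\<lambda>n. ?d n) \<longlonglongrightarrow> ?JJ {} 1 - ?JJ {} 0"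
    by (intro tendsto_diff J_lim)
  ultimately have "?JJ {} 1 - ?JJ {} 0 = integral {0..1} RR"
    using LIMSEQ_unique by blast
  also have "\<dots> \<ge> 0"
  proof (rule integral_nonneg)
    show "RR integrable_on {0..1}" by (rule dom(1))
    show "0 \<le> RR \<theta>" for \<theta>
      unfolding RR_def
    proof (intro sum_nonneg mult_nonneg_nonneg JJ_nonneg)
      show "0 \<le> (CX i j - CY i j) / 2" if "i \<in> I" "j \<in> I - {i}" for i j
        using off_diag[of i j] that by auto
    qed
  qed
  finally have "?JJ {} 0 \<le> ?JJ {} 1" by simp
  moreover have "?JJ {} 0 = (\<integral>\<omega>. (\<Prod>i\<in>I. h i (Y i \<omega>)) \<partial>N)"
  proof -
    have "?JJ {} 0 = (\<integral>\<omega>. (\<Prod>i\<in>I. h i (Y i (snd \<omega>))) \<partial>(M \<Otimes>\<^sub>M N))"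
      by (simp add: interpolant_def kk_def)
    also have "\<dots> = (\<integral>\<omega>. (\<Prod>i\<in>I. h i (Y i (fst \<omega>))) \<partial>(N \<Otimes>\<^sub>M M))"
      by (subst P.integral_product_swap[symmetric]) (auto simp: case_prod_beta')
    also have "\<dots> = (\<integral>\<omega>. (\<Prod>i\<in>I. h i (Y i \<omega>)) \<partial>distr (N \<Otimes>\<^sub>M M) N fst)"
      by (subst integral_distr) auto
    finally show ?thesis by (simp add: M.distr_pair_fst)
  qed
  moreover have "?JJ {} 1 = (\<integral>\<omega>. (\<Prod>i\<in>I. h i (X i \<omega>)) \<partial>M)"
  proof -
    have "?JJ {} 1 = (\<integral>\<omega>. (\<Prod>i\<in>I. h i (X i (fst \<omega>))) \<partial>(M \<Otimes>\<^sub>M N))"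
      by (simp add: interpolant_def kk_def)
    also have "\<dots> = (\<integral>\<omega>. (\<Prod>i\<in>I. h i (X i \<omega>)) \<partial>distr (M \<Otimes>\<^sub>M N) M fst)"
      by (subst integral_distr) auto
    finally show ?thesis by (simp add: N.distr_pair_fst)
  qed
  ultimately show ?thesis by simp
qed
end

section \<open>Smooth steps as limits of trigonometric polynomials\<close>

text \<open>The antiderivative of the Landau kernel \<open>(1 - x\<^sup>2) ^ m\<close> that vanishes
  at 0, expanded binomially: a polynomial composed with a sine is a trigonometric
  polynomial.\<close>

definition landau_poly :: "nat \<Rightarrow> real \<Rightarrow> real" where
  "landau_poly m x = (\<Sum>j\<le>m. real (m choose j) * (- 1) ^ j * x ^ (2 * j + 1) / real (2 * j + 1))"

lemma landau_poly_deriv: "(landau_poly m has_real_derivative (1 - x\<^sup>2) ^ m) (at x)"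
proof -
  have "(landau_poly m has_real_derivative (\<Sum>j\<le>m. real (m choose j) * (- (x\<^sup>2)) ^ j)) (at x)"
    unfolding landau_poly_def
  proof (intro DERIV_sum)
    fix j
    have "((\<lambda>x. x ^ (2 * j + 1) / real (2 * j + 1)) has_real_derivative x ^ (2 * j)) (at x)"
      using DERIV_cdivide[OF DERIV_pow[of "2 * j + 1" x UNIV], of "real (2 * j + 1)"] by simp
    from DERIV_cmult[OF this, of "real (m choose j) * (-1) ^ j"]
    show "((\<lambda>x. real (m choose j) * (- 1) ^ j * x ^ (2 * j + 1) / real (2 * j + 1)) has_real_derivative
      real (m choose j) * (- (x\<^sup>2)) ^ j) (at x)"
      by (simp add: power_minus[of "x\<^sup>2"] power_mult mult.assoc del: of_nat_add of_nat_mult)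
  qed
  also have "(\<Sum>j\<le>m. real (m choose j) * (- (x\<^sup>2)) ^ j) = (1 - x\<^sup>2) ^ m"
    using binomial_ring[of "- (x\<^sup>2)" 1 m] by simp
  finally show ?thesis .
qed

lemma landau_poly_0 [simp]: "landau_poly m 0 = 0"
  by (simp add: landau_poly_def)

lemma landau_poly_minus: "landau_poly m (- x) = - landau_poly m x"
  by (simp add: landau_poly_def sum_negf)

text \<open>Comparison with \<open>arctan (sqrt m * x) / sqrt m\<close>, whose derivative at t is 1
  / (1 + m t^2): by Bernoulli, (1 - t^2)^m (1 + m t^2) \<le> (1 - t^4)^m \<le> 1. The bound is
  uniform in \<open>m\<close>, which the later use of dominated convergence relies on.\<close>

lemma landau_poly_bound:
  assumes "m > 0" "\<bar>x\<bar> \<le> 1"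
  shows "sqrt m * \<bar>landau_poly m x\<bar> \<le> pi / 2"
proof -
  have pos: "0 \<le> landau_poly m x \<and> sqrt m * landau_poly m x \<le> pi / 2" if x: "0 \<le> x" "x \<le> 1" for x
  proof
    have "landau_poly m 0 \<le> landau_poly m x"
      by (rule DERIV_nonneg_imp_nondecreasing[OF x(1)])
         (use x in \<open>auto intro!: exI landau_poly_deriv zero_le_power simp: abs_square_le_1\<close>)
    then show "0 \<le> landau_poly m x" by simp
    have "arctan (sqrt m * 0) / sqrt m - landau_poly m 0 \<le> arctan (sqrt m * x) / sqrt m - landau_poly m x"
    proof (rule DERIV_nonneg_imp_nondecreasing[OF x(1)])
      fix t assume t: "0 \<le> t" "t \<le> x"
      define s where "s = sqrt m"
      have s: "s \<noteq> 0" "s\<^sup>2 = m" using assms(1) by (simp_all add: s_def)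
      have "((\<lambda>x. arctan (s * x)) has_real_derivative inverse (1 + (s * t)\<^sup>2) * s) (at t)"
        by (auto intro!: derivative_eq_intros simp: add_nonneg_eq_0_iff)
      from DERIV_cdivide[OF this, of s]
      have "((\<lambda>x. arctan (s * x) / s) has_real_derivative 1 / (1 + m * t\<^sup>2)) (at t)"
        using s by (simp add: power_mult_distrib inverse_eq_divide)
      then have "((\<lambda>x. arctan (sqrt m * x) / sqrt m - landau_poly m x) has_real_derivative
         1 / (1 + m * t\<^sup>2) - (1 - t\<^sup>2) ^ m) (at t)"
        unfolding s_def by (intro DERIV_diff landau_poly_deriv)
      moreover have "(1 - t\<^sup>2) ^ m \<le> 1 / (1 + m * t\<^sup>2)"
      proof -
        have t2: "t\<^sup>2 \<le> 1" using t x by (simp add: abs_square_le_1)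
        have "(1 - t\<^sup>2) ^ m * (1 + m * t\<^sup>2) \<le> (1 - t\<^sup>2) ^ m * (1 + t\<^sup>2) ^ m"
          using t2 Bernoulli_inequality[of "t\<^sup>2" m] zero_le_power2[of t]
          by (intro mult_left_mono) auto
        also have "\<dots> = (1 - (t\<^sup>2)\<^sup>2) ^ m"
          by (simp add: power_mult_distrib[symmetric] algebra_simps power2_eq_square)
        also have "\<dots> \<le> 1"
          using power_le_one[OF zero_le_power2 t2, of 2] zero_le_power2[of "t\<^sup>2"]
          by (intro power_le_one) linarith+
        finally show ?thesis
          by (simp add: pos_le_divide_eq add_pos_nonneg)
      qed
      ultimately show "\<exists>y. ((\<lambda>x. arctan (sqrt m * x) / sqrt m - landau_poly m x) has_real_derivative y) (at t) \<and> 0 \<le> y"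
        by (intro exI conjI) auto
    qed
    then have "landau_poly m x \<le> arctan (sqrt m * x) / sqrt m" by simp
    then have "sqrt m * landau_poly m x \<le> arctan (sqrt m * x)"
      using assms(1) by (simp add: field_simps)
    also have "\<dots> \<le> pi / 2" using arctan_ubound[of "sqrt m * x"] by simp
    finally show "sqrt m * landau_poly m x \<le> pi / 2" .
  qed
  show ?thesis
    using pos[of "\<bar>x\<bar>"] assms(2) by (cases "0 \<le> x") (auto simp: landau_poly_minus)
qed

text \<open>Substituting a sine and rescaling turns the Landau kernel into
  \<open>cos (z / sqrt N) ^ (2 * N + 1)\<close> with \<open>N = Suc n\<close>, so the limit is the
  integral of \<open>exp (- t\<^sup>2)\<close> from 0 to \<open>z\<close>. The successor avoids
  division by 0.\<close>

definition trig_erf :: "nat \<Rightarrow> real \<Rightarrow> real" where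
  "trig_erf n z = sqrt (Suc n) * landau_poly (Suc n) (sin (z / sqrt (Suc n)))"

lemma trig_erf_0 [simp]: "trig_erf n 0 = 0"
  and trig_erf_minus: "trig_erf n (- z) = - trig_erf n z"
  by (simp_all add: trig_erf_def landau_poly_minus)

lemma trig_erf_deriv: "(trig_erf n has_real_derivative cos (z / sqrt (Suc n)) ^ (2 * n + 3)) (at z)"
proof -
  have "((\<lambda>z. sin (z / s)) has_real_derivative cos (z / s) / s) (at z)" for s
    by (cases "s = 0") (auto intro!: derivative_eq_intros simp: field_simps)
  from DERIV_cmult[OF DERIV_chain'[OF this[of "sqrt (Suc n)"] landau_poly_deriv], of "sqrt (Suc n)"]
  have "(trig_erf n has_real_derivative sqrt (Suc n) * ((1 - (sin (z / sqrt (Suc n)))\<^sup>2) ^ Suc n * (cos (z / sqrt (Suc n)) / sqrt (Suc n)))) (at z)"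
    unfolding trig_erf_def .
  also have "sqrt (Suc n) * ((1 - (sin (z / sqrt (Suc n)))\<^sup>2) ^ Suc n * (cos (z / sqrt (Suc n)) / sqrt (Suc n)))
     = ((cos (z / sqrt (Suc n)))\<^sup>2) ^ Suc n * cos (z / sqrt (Suc n))"
  proof -
    have "s * (p * (q / s)) = p * q" if "s \<noteq> 0" for s p q :: real
      using that by simp
    from this[of "sqrt (Suc n)"] show ?thesis unfolding cos_squared_eq[symmetric] by (simp del: of_nat_Suc)
  qed
  also have "\<dots> = cos (z / sqrt (Suc n)) ^ (2 * n + 3)"
    by (simp only: power_mult[symmetric] power_add[symmetric] power_Suc2[symmetric]) (simp add: eval_nat_numeral)
  finally show ?thesis .
qed

lemma trig_erf_bound: "\<bar>trig_erf n z\<bar> \<le> pi / 2"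
  using landau_poly_bound[of "Suc n" "sin (z / sqrt (Suc n))"] unfolding trig_erf_def abs_mult by simp

lemma trig_poly_erf: "trig_poly (\<lambda>z. trig_erf n (w * z + b))"
proof -
  have *: "trig_poly (\<lambda>z. sin ((w * z + b) * inverse s))" for s
    using trig_poly_sin[of "w * inverse s" "b * inverse s"] by (simp add: algebra_simps)
  show ?thesis
    unfolding trig_erf_def landau_poly_def divide_inverse
    by (intro trig_poly_mult trig_poly_const trig_poly_sum trig_poly_power *)
qed

text \<open>Near 0, \<open>ln (cos x)\<close> behaves like - x^2 / 2, and the exponent is 2 (n + 1)
  + 1, so the logarithm tends to - z^2. The sign of \<open>z\<close> is fixed for
  \<open>real_asymp\<close>; evenness gives the negative case.\<close>

lemma cos_power_limit: "(\<lambda>n. cos (z / sqrt (Suc n)) ^ (2 * n + 3)) \<longlonglongrightarrow> exp (- z\<^sup>2)"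
proof -
  consider "z > 0" | "z = 0" | "z < 0" by linarith
  then show ?thesis
  proof cases
    case 1
    then show ?thesis by (simp only: power2_eq_square) real_asymp
  next
    case 2
    then show ?thesis by simp
  next
    case 3
    define w where "w = - z"
    have "w > 0" using 3 by (simp add: w_def)
    then have "(\<lambda>n. cos (w / sqrt (Suc n)) ^ (2 * n + 3)) \<longlonglongrightarrow> exp (- w\<^sup>2)"
      by (simp only: power2_eq_square) real_asymp
    then show ?thesis by (simp add: w_def)
  qed
qed

text \<open>The affine arguments \<open>w * z + b\<close> are there for the sharpening
  \<open>h (l * (z - a))\<close>, which tends to a unit step at \<open>a\<close> as \<open>l\<close>
  grows.\<close>

lemma smooth_step_exists:
  obtains g g' :: "nat \<Rightarrow> real \<Rightarrow> real" and h h' :: "real \<Rightarrow> real" and B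
  where "\<And>n w b. trig_poly (\<lambda>z. g n (w * z + b))"
    and "\<And>n z. (g n has_real_derivative g' n z) (at z)"
    and "\<And>n z. \<bar>g n z\<bar> \<le> B" "\<And>n z. \<bar>g' n z\<bar> \<le> B"
    and "\<And>n. continuous_on UNIV (g' n)"
    and "\<And>z. (\<lambda>n. g n z) \<longlonglongrightarrow> h z" "\<And>z. (\<lambda>n. g' n z) \<longlonglongrightarrow> h' z"
    and "\<And>z. 0 \<le> h' z" "\<And>z. 0 \<le> h z" "\<And>z. h z \<le> 1"
    and "(h \<longlongrightarrow> 1) at_top" "(h \<longlongrightarrow> 0) at_bot"
proof -
  define J where "J z = integral {0..z} (\<lambda>t::real. exp (- t\<^sup>2))" for z
  define G where "G z = (if 0 \<le> z then J z else - J (- z))" for z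
  have ci: "(\<lambda>t::real. exp (- t\<^sup>2)) integrable_on {a..b}" for a b
    by (intro integrable_continuous_interval continuous_intros)
  have J_lim: "(\<lambda>n. trig_erf n z) \<longlonglongrightarrow> J z" if "0 \<le> z" for z
  proof -
    have "((\<lambda>t. cos (t / sqrt (Suc n)) ^ (2 * n + 3)) has_integral (trig_erf n z - trig_erf n 0)) {0..z}" for n
      using trig_erf_deriv that
      by (intro fundamental_theorem_of_calculus)
         (auto simp: has_real_derivative_iff_has_vector_derivative intro: has_vector_derivative_at_within)
    then have *: "((\<lambda>t. cos (t / sqrt (Suc n)) ^ (2 * n + 3)) has_integral trig_erf n z) {0..z}" for n
      by simp
    have "(\<lambda>n. integral {0..z} (\<lambda>t. cos (t / sqrt (Suc n)) ^ (2 * n + 3))) \<longlonglongrightarrow> J z"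
      unfolding J_def
    proof (rule dominated_convergence(2)[where h="\<lambda>_. 1"])
      show "(\<lambda>t. cos (t / sqrt (Suc n)) ^ (2 * n + 3)) integrable_on {0..z}" for n
        using * by (rule has_integral_integrable)
      show "norm (cos (t / sqrt (Suc n)) ^ (2 * n + 3)) \<le> 1" for n t
        by (simp add: power_abs power_le_one)
    qed (use cos_power_limit in \<open>auto simp del: of_nat_Suc\<close>)
    then show ?thesis unfolding integral_unique[OF *] .
  qed
  have G_lim: "(\<lambda>n. trig_erf n z) \<longlonglongrightarrow> G z" for z
    using J_lim[of z] tendsto_minus[OF J_lim[of "- z"]] by (auto simp: G_def trig_erf_minus)
  have J_le: "J z \<le> pi / 2" if "0 \<le> z" for z
    using J_lim[OF that] by (rule LIMSEQ_le_const2) (meson abs_le_D1 trig_erf_bound)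
  have J_mono: "J y \<le> J z" if "y \<le> z" for y z
    unfolding J_def using that by (intro integral_subset_le ci) auto
  \<comment> \<open>\<open>A\<close> is half the Gaussian integral, kept as a supremum: it is finite
    by the uniform bound \<open>pi / 2\<close> and positive because \<open>J 1\<close> is.\<close>
  define A where "A = (SUP z\<in>{0..}. J z)"
  have bdd: "bdd_above (J ` {0..})" using J_le by (auto intro!: bdd_aboveI[where M="pi / 2"])
  have J_A: "J z \<le> A" if "0 \<le> z" for z
    unfolding A_def using that by (intro cSUP_upper bdd) auto
  have lim_A: "(J \<longlongrightarrow> A) at_top"
  proof (rule increasing_tendsto)
    show "\<forall>\<^sub>F z in at_top. J z \<le> A"
      using eventually_ge_at_top[of 0] by eventually_elim (rule J_A)
    fix x assume "x < A"
    then obtain y where y: "x < J y" "y \<ge> 0"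
      unfolding A_def by (subst (asm) less_cSUP_iff[OF _ bdd]) auto
    show "\<forall>\<^sub>F z in at_top. x < J z"
      using eventually_ge_at_top[of y] by eventually_elim (use y J_mono in fastforce)
  qed
  have "0 < J 1"
  proof -
    have "integral {0..1} (\<lambda>_::real. exp (- 1)) \<le> J 1"
      unfolding J_def by (intro integral_le ci) (auto intro: abs_square_le_1[THEN iffD2])
    then have "exp (- 1) \<le> J 1" by simp
    then show ?thesis by (rule less_le_trans[OF exp_gt_zero])
  qed
  then have A: "A > 0" using J_A[of 1] by simp
  define g where "g n z = (A + trig_erf n z) / (2 * A)" for n z
  define g' where "g' n z = cos (z / sqrt (Suc n)) ^ (2 * n + 3) / (2 * A)" for n z
  define h where "h z = (A + G z) / (2 * A)" for z
  have G_A: "\<bar>G z\<bar> \<le> A" for z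
  proof -
    have "0 \<le> J z" if "0 \<le> z" for z using J_mono[OF that] by (simp add: J_def)
    then show ?thesis using J_A by (auto simp: G_def)
  qed
  show ?thesis
  proof (rule that[of g g' "(A + pi / 2 + 1) / (2 * A)" h "\<lambda>z. exp (- z\<^sup>2) / (2 * A)"])
    show "trig_poly (\<lambda>z. g n (w * z + b))" for n w b
      unfolding g_def divide_inverse by (intro trig_poly_mult trig_poly_add trig_poly_erf trig_poly_const)
    show "(g n has_real_derivative g' n z) (at z)" for n z
      unfolding g_def g'_def by (intro DERIV_cdivide) (auto intro!: derivative_eq_intros trig_erf_deriv)
    show "\<bar>g n z\<bar> \<le> (A + pi / 2 + 1) / (2 * A)" for n z
      using A trig_erf_bound[of n z] by (auto simp: g_def abs_divide intro!: divide_right_mono)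
    show "\<bar>g' n z\<bar> \<le> (A + pi / 2 + 1) / (2 * A)" for n z
    proof -
      have "\<bar>cos (z / sqrt (Suc n)) ^ (2 * n + 3)\<bar> \<le> 1"
        by (simp add: power_abs power_le_one)
      then have "\<bar>cos (z / sqrt (Suc n)) ^ (2 * n + 3)\<bar> \<le> A + pi / 2 + 1"
        using A pi_gt_zero by linarith
      then show ?thesis using A by (auto simp: g'_def abs_divide intro!: divide_right_mono)
    qed
    show "continuous_on UNIV (g' n)" for n
      unfolding g'_def using A by (intro continuous_intros) auto
    show "(\<lambda>n. g n z) \<longlonglongrightarrow> h z" for z
      unfolding g_def h_def using A by (intro tendsto_intros G_lim) auto
    show "(\<lambda>n. g' n z) \<longlonglongrightarrow> exp (- z\<^sup>2) / (2 * A)" for z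
      unfolding g'_def using A by (intro tendsto_intros cos_power_limit) auto
    show "0 \<le> exp (- z\<^sup>2) / (2 * A)" "0 \<le> h z" "h z \<le> 1" for z
      using A G_A[of z] by (auto simp: h_def field_simps abs_le_iff)
    have "(G \<longlongrightarrow> A) at_top"
      using lim_A by (rule Lim_transform_eventually)
         (auto simp: G_def intro!: eventually_mono[OF eventually_ge_at_top[of 0]])
    then have "(h \<longlongrightarrow> (A + A) / (2 * A)) at_top"
      unfolding h_def using A by (intro tendsto_intros) auto
    then show "(h \<longlongrightarrow> 1) at_top" using A by simp
    have "(G \<longlongrightarrow> - A) at_bot"
      using tendsto_minus[OF filterlim_compose[OF lim_A filterlim_uminus_at_top_at_bot]]
      by (rule Lim_transform_eventually)
         (auto simp: G_def intro!: eventually_mono[OF eventually_gt_at_bot[of 0]])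
    then have "(h \<longlongrightarrow> (A + - A) / (2 * A)) at_bot"
      unfolding h_def using A by (intro tendsto_intros) auto
    then show "(h \<longlongrightarrow> 0) at_bot" by simp
  qed
qed

section \<open>Slepian's inequality\<close>

context gaussian_comparison begin

text \<open>At its threshold the limiting step function has the value \<open>h 0\<close>, which lies
  in [0, 1]. It is therefore above the indicator of the strict event and below that of the weak one,
  which takes care of atoms of degenerate coordinates.\<close>

theorem slepian:
  "measure N {\<omega> \<in> space N. \<forall>i\<in>I. a i < Y i \<omega>} \<le> measure M {\<omega> \<in> space M. \<forall>i\<in>I. a i \<le> X i \<omega>}"
proof -
  obtain g g' :: "nat \<Rightarrow> real \<Rightarrow> real" and h h' :: "real \<Rightarrow> real" and B
    where trig: "\<And>n w b. trig_poly (\<lambda>z. g n (w * z + b))"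
    and deriv: "\<And>n z. (g n has_real_derivative g' n z) (at z)"
    and bound: "\<And>n z. \<bar>g n z\<bar> \<le> B" "\<And>n z. \<bar>g' n z\<bar> \<le> B"
    and cont: "\<And>n. continuous_on UNIV (g' n)"
    and lim: "\<And>z. (\<lambda>n. g n z) \<longlonglongrightarrow> h z" "\<And>z. (\<lambda>n. g' n z) \<longlonglongrightarrow> h' z"
    and nonneg: "\<And>z. 0 \<le> h' z" "\<And>z. 0 \<le> h z" and le1: "\<And>z. h z \<le> 1"
    and top: "(h \<longlongrightarrow> 1) at_top" and bot: "(h \<longlongrightarrow> 0) at_bot"
    by (rule smooth_step_exists) (rule that, assumption+)
  have B: "0 \<le> B" using bound(1)[of 0 0] by linarith
  have h_meas [measurable]: "h \<in> borel_measurable borel"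
  proof (rule borel_measurable_LIMSEQ_real[OF lim(1)])
    show "g n \<in> borel_measurable borel" for n
      using deriv by (intro borel_measurable_continuous_onI) (meson DERIV_isCont continuous_at_imp_continuous_on)
  qed
  define H where "H l i z = h (real l * z + - (real l * a i))" for l :: nat and i z
  have H_meas [measurable]: "H l i \<in> borel_measurable borel" for l i
    unfolding H_def by measurable
  have H_bounds: "0 \<le> H l i z" "H l i z \<le> 1" for l i z
    using nonneg le1 by (auto simp: H_def)
  have ineq: "(\<integral>\<omega>. (\<Prod>i\<in>I. H l i (Y i \<omega>)) \<partial>N) \<le> (\<integral>\<omega>. (\<Prod>i\<in>I. H l i (X i \<omega>)) \<partial>M)" for l
    unfolding H_def
  proof (rule expectation_limit_mono)
    show "trig_poly (\<lambda>z. g n (real l * z + - (real l * a i)))" for n i by (rule trig)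
    show "((\<lambda>z. g n (real l * z + - (real l * a i))) has_real_derivative g' n (real l * z + - (real l * a i)) * real l) (at z)" for n i z
      by (rule DERIV_chain2[OF deriv]) (auto intro!: derivative_eq_intros)
    \<comment> \<open>The bound may depend on \<open>l\<close>, the factor from the chain rule,
      because the limit in \<open>n\<close> is taken first with \<open>l\<close> fixed.\<close>
    show "\<bar>g n (real l * z + - (real l * a i))\<bar> \<le> max B (B * real l)" for n i z
      using bound(1) by (rule max.coboundedI1)
    show "\<bar>g' n (real l * z + - (real l * a i)) * real l\<bar> \<le> max B (B * real l)" for n i z
      unfolding abs_mult using bound(2) by (intro max.coboundedI2 mult_mono) (auto simp: B)
    show "(\<lambda>z. g' n (real l * z + - (real l * a i)) * real l) \<in> borel_measurable borel" for n i
      by (intro borel_measurable_continuous_onI continuous_intros continuous_on_compose2[OF cont]) auto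
    show "(\<lambda>n. g n (real l * z + - (real l * a i))) \<longlonglongrightarrow> h (real l * z + - (real l * a i))" for i z
      by (rule lim)
    show "(\<lambda>n. g' n (real l * z + - (real l * a i)) * real l) \<longlonglongrightarrow> h' (real l * z + - (real l * a i)) * real l" for i z
      by (intro tendsto_intros lim)
  qed (use nonneg in auto)
  define s where "s i z = (if a i < z then 1 else if z = a i then h 0 else 0)" for i z
  have s_meas [measurable]: "s i \<in> borel_measurable borel" for i
    unfolding s_def by measurable
  have H_lim: "(\<lambda>l. H l i z) \<longlonglongrightarrow> s i z" for i z
  proof -
    have eq: "H l i z = h (real l * (z - a i))" for l by (simp add: H_def algebra_simps)
    consider "a i < z" | "z = a i" | "z < a i" by linarith
    then show ?thesis
    proof cases
      case 1
      then have "filterlim (\<lambda>l. real l * (z - a i)) at_top sequentially"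
        by (intro filterlim_at_top_mult_tendsto_pos[OF tendsto_const _ filterlim_real_sequentially, where c="z - a i"]) auto
      from filterlim_compose[OF top this] show ?thesis using 1 by (simp add: eq s_def)
    next
      case 2
      then show ?thesis by (simp add: H_def s_def)
    next
      case 3
      then have "filterlim (\<lambda>l. real l * (a i - z)) at_top sequentially"
        by (intro filterlim_at_top_mult_tendsto_pos[OF tendsto_const _ filterlim_real_sequentially, where c="a i - z"]) auto
      from filterlim_compose[OF filterlim_uminus_at_bot_at_top this]
      have "filterlim (\<lambda>l. real l * (z - a i)) at_bot sequentially"
        by (simp add: algebra_simps)
      from filterlim_compose[OF bot this] show ?thesis using 3 by (simp add: eq s_def)
    qed
  qed
  have prod1: "\<bar>\<Prod>i\<in>I. f i\<bar> \<le> 1" if "\<And>i. 0 \<le> f i" "\<And>i. f i \<le> 1" for f :: "'i \<Rightarrow> real"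
    using that by (simp add: abs_prod prod_le_1)
  have "(\<lambda>l. \<integral>\<omega>. (\<Prod>i\<in>I. H l i (Y i \<omega>)) \<partial>N) \<longlonglongrightarrow> (\<integral>\<omega>. (\<Prod>i\<in>I. s i (Y i \<omega>)) \<partial>N)"
    by (rule integral_dominated_convergence[where w="\<lambda>_. 1"])
       (auto intro!: tendsto_prod H_lim prod1 H_bounds)
  moreover have "(\<lambda>l. \<integral>\<omega>. (\<Prod>i\<in>I. H l i (X i \<omega>)) \<partial>M) \<longlonglongrightarrow> (\<integral>\<omega>. (\<Prod>i\<in>I. s i (X i \<omega>)) \<partial>M)"
    by (rule integral_dominated_convergence[where w="\<lambda>_. 1"])
       (auto intro!: tendsto_prod H_lim prod1 H_bounds)
  ultimately have le: "(\<integral>\<omega>. (\<Prod>i\<in>I. s i (Y i \<omega>)) \<partial>N) \<le> (\<integral>\<omega>. (\<Prod>i\<in>I. s i (X i \<omega>)) \<partial>M)"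
    by (rule LIMSEQ_le) (use ineq in blast)
  have s_bounds: "0 \<le> s i z" "s i z \<le> 1" for i z
    using nonneg le1 by (auto simp: s_def)
  let ?A = "{\<omega> \<in> space N. \<forall>i\<in>I. a i < Y i \<omega>}" and ?B = "{\<omega> \<in> space M. \<forall>i\<in>I. a i \<le> X i \<omega>}"
  have A [measurable]: "?A \<in> sets N" and Bm [measurable]: "?B \<in> sets M"
    using finite_I by measurable
  have "measure N ?A = (\<integral>\<omega>. indicator ?A \<omega> \<partial>N)" by simp
  also have "\<dots> \<le> (\<integral>\<omega>. (\<Prod>i\<in>I. s i (Y i \<omega>)) \<partial>N)"
  proof (rule integral_mono)
    show "integrable N (indicator ?A :: _ \<Rightarrow> real)"
      by (rule N.integrable_const_bound[where B=1]) (use A in \<open>auto simp: indicator_def\<close>)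
    show "integrable N (\<lambda>\<omega>. \<Prod>i\<in>I. s i (Y i \<omega>))"
      by (rule N.integrable_const_bound[where B=1]) (auto intro!: prod1 s_bounds)
    show "indicator ?A \<omega> \<le> (\<Prod>i\<in>I. s i (Y i \<omega>))" for \<omega>
      using s_bounds by (auto simp: indicator_def s_def prod_nonneg)
  qed
  also note le
  also have "(\<integral>\<omega>. (\<Prod>i\<in>I. s i (X i \<omega>)) \<partial>M) \<le> (\<integral>\<omega>. indicator ?B \<omega> \<partial>M)"
  proof (rule integral_mono)
    show "integrable M (indicator ?B :: _ \<Rightarrow> real)"
      by (rule M.integrable_const_bound[where B=1]) (use Bm in \<open>auto simp: indicator_def\<close>)
    show "integrable M (\<lambda>\<omega>. \<Prod>i\<in>I. s i (X i \<omega>))"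
      by (rule M.integrable_const_bound[where B=1]) (auto intro!: prod1 s_bounds)
    show "(\<Prod>i\<in>I. s i (X i \<omega>)) \<le> indicator ?B \<omega>" if "\<omega> \<in> space M" for \<omega>
    proof (cases "\<omega> \<in> ?B")
      case True
      then show ?thesis using s_bounds by (simp add: prod_le_1)
    next
      case False
      then have "\<exists>i\<in>I. \<not> a i \<le> X i \<omega>" using \<open>\<omega> \<in> space M\<close> by blast
      then obtain i where "i \<in> I" "X i \<omega> < a i" by (auto simp only: not_le)
      then have "(\<Prod>i\<in>I. s i (X i \<omega>)) = 0"
        using finite_I by (intro prod_zero bexI[of _ i]) (auto simp: s_def)
      then show ?thesis by simp
    qed
  qed
  also have "\<dots> = measure M ?B" by simp
  finally show ?thesis .
qed
end

section \<open>Survival probabilities of drifted Brownian motion\<close>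

abbreviation "stdN \<equiv> density lborel (\<lambda>x. ennreal (std_normal_density x))"

interpretation stdN: real_distribution stdN by (rule real_dist_normal_dist)

text \<open>For Brownian motion with drift \<open>- k\<close>, reflection at the origin carries the Girsanov weight
  \<open>exp (2 * k * z)\<close>. Hence the expectation of \<open>ruin_test\<close> at time \<open>\<tau>\<close>, starting from \<open>z \<ge> 0\<close>, is the
  probability of staying positive up to time \<open>\<tau>\<close>.\<close>

definition ruin_test :: "real \<Rightarrow> real \<Rightarrow> real" where
  "ruin_test k z = (if 0 < z then 1 else if z < 0 then - exp (2 * k * z) else 0)"

definition survival :: "real \<Rightarrow> real \<Rightarrow> real \<Rightarrow> real" where
  "survival k z \<tau> = (\<integral>y. ruin_test k (z - k * \<tau> + sqrt \<tau> * y) \<partial>stdN)"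

lemma ruin_test_measurable [measurable]: "ruin_test k \<in> borel_measurable borel"
  unfolding ruin_test_def by measurable

lemma ruin_test_bound: "0 < k \<Longrightarrow> \<bar>ruin_test k z\<bar> \<le> 1"
  by (simp add: ruin_test_def mult_nonneg_nonpos)

lemma survival_measurable [measurable]: "(\<lambda>z. survival k z \<tau>) \<in> borel_measurable borel"
  unfolding survival_def by measurable

lemma stdN_integral_bound:
  assumes "f \<in> borel_measurable borel" "\<And>x. \<bar>f x\<bar> \<le> (1::real)"
  shows "integrable stdN f" "\<bar>\<integral>x. f x \<partial>stdN\<bar> \<le> 1"
proof -
  show 1: "integrable stdN f"
    using assms by (intro stdN.integrable_const_bound[where B=1]) auto
  have "(\<integral>x. \<bar>f x\<bar> \<partial>stdN) \<le> 1"
    using assms 1 by (intro stdN.integral_le_const) auto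
  then show "\<bar>\<integral>x. f x \<partial>stdN\<bar> \<le> 1"
    using integral_norm_bound[of stdN f] unfolding real_norm_def by linarith
qed

lemma survival_abs_le_1: "0 < k \<Longrightarrow> \<bar>survival k z \<tau>\<bar> \<le> 1"
  unfolding survival_def by (intro stdN_integral_bound ruin_test_bound) measurable

lemma survival_0: "survival k z 0 = ruin_test k z"
  using stdN.prob_space by (simp add: survival_def)

lemma char_stdN: "(\<integral>y. iexp (t * y) \<partial>stdN) = of_real (exp (- t\<^sup>2 / 2))"
  using char_std_normal_distribution by (simp add: char_def fun_eq_iff)

interpretation stdN2: pair_prob_space stdN stdN ..

text \<open>Characteristic functions treat zero variances like all others; they do occur, since no
  time remains after the last step of the walk.\<close>

lemma stdN_convolution:
  assumes "0 \<le> a" "0 \<le> b"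
  shows "distr (stdN \<Otimes>\<^sub>M stdN) borel (\<lambda>(x, y). sqrt a * x + sqrt b * y) = distr stdN borel (\<lambda>x. sqrt (a + b) * x)"
    (is "?L = ?R")
proof (rule Levy_uniqueness)
  have [measurable]: "(\<lambda>(x, y). sqrt a * x + sqrt b * y) \<in> borel_measurable (stdN \<Otimes>\<^sub>M stdN)"
    by measurable
  show "real_distribution ?L" by (intro stdN2.real_distribution_distr) simp
  show "real_distribution ?R" by (intro stdN.real_distribution_distr) simp
  show "char ?L = char ?R"
  proof
    fix t
    have int: "integrable (stdN \<Otimes>\<^sub>M stdN) (\<lambda>p. iexp (t * (sqrt a * fst p + sqrt b * snd p)))"
      by (rule stdN2.integrable_const_bound[where B=1]) auto
    have "char ?L t = (\<integral>p. iexp (t * (sqrt a * fst p + sqrt b * snd p)) \<partial>(stdN \<Otimes>\<^sub>M stdN))"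
      unfolding char_def by (subst integral_distr) (auto simp: split_beta)
    also have "\<dots> = (\<integral>x. \<integral>y. iexp (t * (sqrt a * x + sqrt b * y)) \<partial>stdN \<partial>stdN)"
      using stdN2.integral_fst'[OF int] by simp
    also have "\<dots> = (\<integral>x. \<integral>y. iexp ((t * sqrt a) * x) * iexp ((t * sqrt b) * y) \<partial>stdN \<partial>stdN)"
      by (simp add: exp_add[symmetric] algebra_simps)
    also have "\<dots> = of_real (exp (- (t * sqrt a)\<^sup>2 / 2)) * of_real (exp (- (t * sqrt b)\<^sup>2 / 2))"
      unfolding integral_mult_right_zero integral_mult_left_zero char_stdN ..
    also have "\<dots> = of_real (exp (- (t * sqrt (a + b))\<^sup>2 / 2))"
      unfolding of_real_mult[symmetric] exp_add[symmetric] using assms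
      by (simp add: power_mult_distrib field_simps)
    also have "\<dots> = (\<integral>y. iexp ((t * sqrt (a + b)) * y) \<partial>stdN)"
      by (simp only: char_stdN)
    also have "\<dots> = char ?R t"
      unfolding char_def by (subst integral_distr) (auto simp: mult.assoc)
    finally show "char ?L t = char ?R t" .
  qed
qed

text \<open>Chapman-Kolmogorov for free Gaussian motion: killing at the origin is encoded in the
  test function alone, so only the convolution of two normal laws is involved.\<close>

lemma survival_semigroup:
  assumes "0 < k" "0 \<le> \<delta>" "0 \<le> \<tau>"
  shows "(\<integral>y. survival k (z - k * \<delta> + sqrt \<delta> * y) \<tau> \<partial>stdN) = survival k z (\<delta> + \<tau>)"
proof -
  let ?f = "\<lambda>w. ruin_test k (z - k * (\<delta> + \<tau>) + w)"
  have int: "integrable (stdN \<Otimes>\<^sub>M stdN) (\<lambda>p. ?f (sqrt \<delta> * fst p + sqrt \<tau> * snd p))"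
    by (rule stdN2.integrable_const_bound[where B=1]) (auto intro: ruin_test_bound[OF assms(1)])
  have "(\<integral>y. survival k (z - k * \<delta> + sqrt \<delta> * y) \<tau> \<partial>stdN) = (\<integral>x. \<integral>y. ?f (sqrt \<delta> * x + sqrt \<tau> * y) \<partial>stdN \<partial>stdN)"
    unfolding survival_def by (simp add: algebra_simps)
  also have "\<dots> = (\<integral>p. ?f (sqrt \<delta> * fst p + sqrt \<tau> * snd p) \<partial>(stdN \<Otimes>\<^sub>M stdN))"
    using stdN2.integral_fst'[OF int] by simp
  also have "\<dots> = (\<integral>w. ?f w \<partial>distr (stdN \<Otimes>\<^sub>M stdN) borel (\<lambda>(x, y). sqrt \<delta> * x + sqrt \<tau> * y))"
    by (subst integral_distr) (auto simp: split_beta)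
  also have "\<dots> = survival k z (\<delta> + \<tau>)"
    unfolding stdN_convolution[OF assms(2,3)] survival_def by (subst integral_distr) auto
  finally show ?thesis .
qed

text \<open>Pairing \<open>v > 0\<close> with \<open>- v\<close> turns the test function into the density of a drifted Brownian
  motion killed at the origin.\<close>

lemma survival_kernel:
  assumes k: "0 < k" and \<tau>: "0 < \<tau>"
  shows "integrable lborel (\<lambda>v. indicator {0<..} v * (normal_density (z - k * \<tau>) (sqrt \<tau>) v * (1 - exp (- 2 * v * z / \<tau>))))"
    and "survival k z \<tau> = (\<integral>v. indicator {0<..} v * (normal_density (z - k * \<tau>) (sqrt \<tau>) v * (1 - exp (- 2 * v * z / \<tau>))) \<partial>lborel)"
proof -
  let ?m = "z - k * \<tau>"
  let ?p = "normal_density ?m (sqrt \<tau>)"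
  have aff: "std_normal_density y = sqrt \<tau> * ?p (?m + sqrt \<tau> * y)" for y
    using \<tau> by (simp add: normal_density_def std_normal_density_def real_sqrt_mult power_mult_distrib)
  have "survival k z \<tau> = (\<integral>y. std_normal_density y * ruin_test k (?m + sqrt \<tau> * y) \<partial>lborel)"
    unfolding survival_def by (subst integral_density) auto
  also have "\<dots> = \<bar>sqrt \<tau>\<bar> * (\<integral>y. ?p (?m + sqrt \<tau> * y) * ruin_test k (?m + sqrt \<tau> * y) \<partial>lborel)"
    unfolding aff using \<tau> by (simp add: mult.assoc)
  also have "\<dots> = (\<integral>v. ?p v * ruin_test k v \<partial>lborel)"
    using lborel_integral_real_affine[of "sqrt \<tau>" "\<lambda>v. ?p v * ruin_test k v" ?m] \<tau> by simp
  finally have 1: "survival k z \<tau> = (\<integral>v. ?p v * ruin_test k v \<partial>lborel)" .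
  have intp: "integrable lborel (\<lambda>v. ?p v * ruin_test k v)"
    by (rule Bochner_Integration.integrable_bound[OF integrable_normal_density[where \<mu>="?m" and \<sigma>="sqrt \<tau>"]])
       (use \<tau> ruin_test_bound[OF k] in \<open>auto simp: abs_mult mult_left_le\<close>)
  have i1: "integrable lborel (\<lambda>v. indicator {0<..} v * (?p v * ruin_test k v))"
    using integrable_mult_indicator[OF _ intp, of "{0<..}"] by simp
  have i2: "integrable lborel (\<lambda>v. indicator {..<0} v * (?p v * ruin_test k v))"
    using integrable_mult_indicator[OF _ intp, of "{..<0}"] by simp
  have i3: "integrable lborel (\<lambda>v. indicator {..<0} (- v) * (?p (- v) * ruin_test k (- v)))"
    using lborel_integrable_real_affine[OF i2, of "-1" 0] by simp
  have "(\<integral>v. ?p v * ruin_test k v \<partial>lborel) = (\<integral>v. indicator {0<..} v * (?p v * ruin_test k v) + indicator {..<0} v * (?p v * ruin_test k v) \<partial>lborel)"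
    by (intro Bochner_Integration.integral_cong refl) (auto simp: indicator_def ruin_test_def)
  also have "\<dots> = (\<integral>v. indicator {0<..} v * (?p v * ruin_test k v) \<partial>lborel) + (\<integral>v. indicator {..<0} v * (?p v * ruin_test k v) \<partial>lborel)"
    using i1 i2 by simp
  also have "(\<integral>v. indicator {..<0} v * (?p v * ruin_test k v) \<partial>lborel) = (\<integral>v. indicator {..<0} (- v) * (?p (- v) * ruin_test k (- v)) \<partial>lborel)"
    using lborel_integral_real_affine[of "-1" "\<lambda>v. indicator {..<0} v * (?p v * ruin_test k v)" 0] by simp
  also have "(\<integral>v. indicator {0<..} v * (?p v * ruin_test k v) \<partial>lborel) + \<dots>
     = (\<integral>v. indicator {0<..} v * (?p v * ruin_test k v) + indicator {..<0} (- v) * (?p (- v) * ruin_test k (- v)) \<partial>lborel)"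
    using i1 i3 by simp
  finally have 2: "survival k z \<tau> = \<dots>" using 1 by simp
  \<comment> \<open>The reflection weight cancels the drift: the two exponents differ by a term
    linear in \<open>v\<close> that no longer contains \<open>k\<close>.\<close>
  have refl: "exp (- 2 * k * v) * ?p (- v) = ?p v * exp (- 2 * v * z / \<tau>)" for v
  proof -
    have "- 2 * k * v + - (- v - ?m)\<^sup>2 / (2 * \<tau>) = - (v - ?m)\<^sup>2 / (2 * \<tau>) + - 2 * v * z / \<tau>"
    proof -
      have "(- v - ?m)\<^sup>2 = (v - ?m)\<^sup>2 + 4 * v * ?m"
        by (simp add: power2_eq_square algebra_simps)
      moreover have "2 * v * z / \<tau> = 2 * k * v + 4 * v * ?m / (2 * \<tau>)"
        using \<tau> by (simp add: field_simps)
      ultimately show ?thesis by (simp add: add_divide_distrib diff_divide_distrib)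
    qed
    then have "exp (- 2 * k * v) * exp (- (- v - ?m)\<^sup>2 / (2 * \<tau>)) = exp (- (v - ?m)\<^sup>2 / (2 * \<tau>)) * exp (- 2 * v * z / \<tau>)"
      unfolding exp_add[symmetric] by (simp only:)
    then show ?thesis
      using \<tau> by (simp add: normal_density_def)
  qed
  have eq: "indicator {0<..} v * (?p v * ruin_test k v) + indicator {..<0} (- v) * (?p (- v) * ruin_test k (- v))
    = indicator {0<..} v * (?p v * (1 - exp (- 2 * v * z / \<tau>)))" for v
    using refl[of v] by (auto simp: indicator_def ruin_test_def algebra_simps)
  show "integrable lborel (\<lambda>v. indicator {0<..} v * (?p v * (1 - exp (- 2 * v * z / \<tau>))))"
    using Bochner_Integration.integrable_add[OF i1 i3] unfolding eq .
  show "survival k z \<tau> = (\<integral>v. indicator {0<..} v * (?p v * (1 - exp (- 2 * v * z / \<tau>))) \<partial>lborel)"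
    using 2 unfolding eq .
qed

text \<open>In \<open>survival_kernel\<close> the factor
  \<open>1 - exp (- 2 * v * z / \<tau>)\<close> with \<open>v > 0\<close> has the sign of
  \<open>z\<close>.\<close>

lemma survival_nonpos:
  assumes "0 < k" "0 \<le> \<tau>" "z \<le> 0"
  shows "survival k z \<tau> \<le> 0"
proof (cases "\<tau> = 0")
  case True
  then show ?thesis using assms by (simp add: survival_0 ruin_test_def)
next
  case False
  then have \<tau>: "0 < \<tau>" using assms by simp
  have "0 \<le> (\<integral>v. - (indicator {0<..} v * (normal_density (z - k * \<tau>) (sqrt \<tau>) v * (1 - exp (- 2 * v * z / \<tau>)))) \<partial>lborel)"
  proof (intro integral_nonneg_AE AE_I2)
    fix v :: real
    have "2 * v * z / \<tau> \<le> 0" if "0 < v"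
      using that assms \<tau> by (intro divide_nonpos_pos mult_nonneg_nonpos) auto
    then have "0 \<le> normal_density (z - k * \<tau>) (sqrt \<tau>) v * (exp (- 2 * v * z / \<tau>) - 1)" if "0 < v"
      using that by (intro mult_nonneg_nonneg) auto
    then show "0 \<le> - (indicator {0<..} v * (normal_density (z - k * \<tau>) (sqrt \<tau>) v * (1 - exp (- 2 * v * z / \<tau>))))"
      by (auto simp: indicator_def algebra_simps)
  qed
  then show ?thesis unfolding survival_kernel(2)[OF assms(1) \<tau>] by simp
qed

lemma survival_nonneg:
  assumes "0 < k" "0 \<le> \<tau>" "0 \<le> z"
  shows "0 \<le> survival k z \<tau>"
proof (cases "\<tau> = 0")
  case True
  then show ?thesis using assms by (simp add: survival_0 ruin_test_def)
next
  case False
  then have \<tau>: "0 < \<tau>" using assms by simp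
  show ?thesis unfolding survival_kernel(2)[OF assms(1) \<tau>]
    using assms \<tau> by (intro integral_nonneg_AE AE_I2) (auto simp: indicator_def intro!: mult_nonneg_nonneg)
qed

section \<open>Gaussian random walks above a line\<close>

interpretation stdNs: product_sigma_finite "\<lambda>_::nat. stdN" ..

abbreviation "stdP n \<equiv> Pi\<^sub>M {..n::nat} (\<lambda>_. stdN)"

lemma prob_space_stdP: "prob_space (stdP n)"
  by (rule prob_space_PiM) (rule stdN.prob_space_axioms)

text \<open>Step 0 carries the variance of the starting value. Time along the line starts after it,
  which is why the line in \<open>walk_stays_above\<close> sums \<open>v\<close> over
  \<open>{1..i}\<close>.\<close>

definition walk :: "(nat \<Rightarrow> real) \<Rightarrow> nat \<Rightarrow> (nat \<Rightarrow> real) \<Rightarrow> real" where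
  "walk v i \<omega> = (\<Sum>j\<le>i. sqrt (v j) * \<omega> j)"

lemma walk_measurable: "i \<le> n \<Longrightarrow> walk v i \<in> borel_measurable (stdP n)"
  unfolding walk_def by measurable

text \<open>Summation by parts: \<open>b j\<close> is the total weight of the independent coordinate
  \<open>j\<close>, so the integral factorises; expanding the squares again gives the covariances,
  the partial sums of \<open>v\<close> up to \<open>min i j\<close>.\<close>

lemma char_walk:
  assumes v: "\<And>j. 0 \<le> v j"
  shows "(\<integral>\<omega>. cis (\<Sum>i\<le>n. a i * walk v i \<omega>) \<partial>stdP n)
    = of_real (exp (- (\<Sum>i\<le>n. \<Sum>j\<le>n. a i * a j * (\<Sum>l\<le>min i j. v l)) / 2))"
proof -
  define b where "b j = (\<Sum>i\<in>{i. i \<le> n \<and> j \<le> i}. a i)" for j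
  have b_eq: "b j = (\<Sum>i\<le>n. if j \<le> i then a i else 0)" for j
    unfolding b_def by (rule sum.mono_neutral_cong_left) auto
  have s1: "(\<Sum>i\<le>n. a i * walk v i \<omega>) = (\<Sum>j\<le>n. b j * sqrt (v j) * \<omega> j)" for \<omega>
  proof -
    have "(\<Sum>i\<le>n. a i * walk v i \<omega>) = (\<Sum>i\<le>n. \<Sum>j\<le>n. if j \<le> i then a i * (sqrt (v j) * \<omega> j) else 0)"
      unfolding walk_def sum_distrib_left
      by (intro sum.cong refl sum.mono_neutral_cong_left) auto
    also have "\<dots> = (\<Sum>j\<le>n. \<Sum>i\<le>n. if j \<le> i then a i * (sqrt (v j) * \<omega> j) else 0)"
      by (rule sum.swap)
    also have "\<dots> = (\<Sum>j\<le>n. b j * sqrt (v j) * \<omega> j)"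
      unfolding b_eq sum_distrib_right by (intro sum.cong refl) auto
    finally show ?thesis .
  qed
  have int: "integrable stdN (\<lambda>x. cis (b j * sqrt (v j) * x))" for j
    by (rule stdN.integrable_const_bound[where B=1]) (auto simp: cis_conv_exp)
  have c: "(\<integral>x. cis (b j * sqrt (v j) * x) \<partial>stdN) = of_real (exp (- ((b j)\<^sup>2 * v j) / 2))" for j
    using char_stdN[of "b j * sqrt (v j)"] v by (simp add: cis_conv_exp power_mult_distrib)
  have "(\<integral>\<omega>. cis (\<Sum>i\<le>n. a i * walk v i \<omega>) \<partial>stdP n) = (\<integral>\<omega>. (\<Prod>j\<le>n. cis (b j * sqrt (v j) * \<omega> j)) \<partial>stdP n)"
    unfolding s1 cis_sum ..
  also have "\<dots> = (\<Prod>j\<le>n. of_real (exp (- ((b j)\<^sup>2 * v j) / 2)))"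
    by (subst stdNs.product_integral_prod) (simp_all add: int c)
  also have "\<dots> = of_real (exp (- (\<Sum>j\<le>n. (b j)\<^sup>2 * v j) / 2))"
    by (simp add: exp_sum sum_divide_distrib flip: sum_negf)
  also have "(\<Sum>j\<le>n. (b j)\<^sup>2 * v j) = (\<Sum>i\<le>n. \<Sum>j\<le>n. a i * a j * (\<Sum>l\<le>min i j. v l))"
  proof -
    have "(\<Sum>l\<le>n. (b l)\<^sup>2 * v l) = (\<Sum>l\<le>n. \<Sum>i\<le>n. \<Sum>j\<le>n. if l \<le> min i j then a i * a j * v l else 0)"
      unfolding b_eq power2_eq_square sum_product unfolding sum_distrib_right
      by (intro sum.cong refl) auto
    also have "\<dots> = (\<Sum>i\<le>n. \<Sum>l\<le>n. \<Sum>j\<le>n. if l \<le> min i j then a i * a j * v l else 0)"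
      by (rule sum.swap)
    also have "\<dots> = (\<Sum>i\<le>n. \<Sum>j\<le>n. \<Sum>l\<le>n. if l \<le> min i j then a i * a j * v l else 0)"
      by (intro sum.cong refl sum.swap)
    also have "\<dots> = (\<Sum>i\<le>n. \<Sum>j\<le>n. a i * a j * (\<Sum>l\<le>min i j. v l))"
      unfolding sum_distrib_left
      by (intro sum.cong refl sum.mono_neutral_cong_right) auto
    finally show ?thesis .
  qed
  finally show ?thesis .
qed

text \<open>Weighting the event of staying above the line so far with the signed kernel \<open>survival\<close> gives a
  submartingale, because \<open>survival\<close> is nonpositive below the line.\<close>

lemma walk_stays_above:
  assumes k: "0 < k" and v: "\<And>j. 0 \<le> v j"
  shows "(\<integral>x. indicator {0<..} (sqrt (v 0) * x - U) * survival k (sqrt (v 0) * x - U) (\<Sum>j\<in>{1..n}. v j) \<partial>stdN)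
    \<le> measure (stdP n) {\<omega> \<in> space (stdP n). \<forall>i\<in>{..n}. U + k * (\<Sum>j\<in>{1..i}. v j) < walk v i \<omega>}"
proof -
  define Z where "Z i \<omega> = walk v i \<omega> - U - k * (\<Sum>j\<in>{1..i}. v j)" for i \<omega>
  have Z_meas: "Z i \<in> borel_measurable (stdP m)" if "i \<le> m" for i m
    unfolding Z_def using walk_measurable[OF that] by measurable
  define A where "A m = {\<omega> \<in> space (stdP m). \<forall>i\<le>m. 0 < Z i \<omega>}" for m
  have A_meas [measurable]: "A m \<in> sets (stdP m)" for m
    unfolding A_def using Z_meas[of _ m] by measurable
  \<comment> \<open>The time that remains after step \<open>m\<close>.\<close>
  define r where "r m = (\<Sum>j\<in>{Suc m..n}. v j)" for m
  have r_nonneg: "0 \<le> r m" for m using v by (simp add: r_def sum_nonneg)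
  have survival_meas: "(\<lambda>\<omega>. survival k (Z m \<omega>) (r m)) \<in> borel_measurable (stdP m)" for m
    using Z_meas[of m m] by measurable
  \<comment> \<open>This quantity increases with \<open>m\<close>. At \<open>m = n\<close> no time
    remains and \<open>survival\<close> is 1 above the line, so \<open>e n\<close> is the
    probability sought, while \<open>e 0\<close> is the integral on the left.\<close>
  define e where "e m = (\<integral>\<omega>. indicator (A m) \<omega> * survival k (Z m \<omega>) (r m) \<partial>stdP m)" for m
  have ind_bound: "\<bar>indicator S x * survival k z t\<bar> \<le> 1" for S :: "'x set" and x z t
    using survival_abs_le_1[OF k, of z t] by (auto simp: indicator_def)
  have int_e: "integrable (stdP m) (\<lambda>\<omega>. indicator (A m) \<omega> * survival k (Z m \<omega>) (r m))" for m
  proof -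
    interpret prob_space "stdP m" by (rule prob_space_stdP)
    show ?thesis
      by (rule integrable_const_bound[where B=1]) (use survival_meas[of m] in \<open>auto simp: ind_bound\<close>)
  qed
  have step: "e m \<le> e (Suc m)" if m: "m < n" for m
  proof -
    have ins: "{..Suc m} = insert (Suc m) {..m}" by auto
    have r_Suc: "r m = v (Suc m) + r (Suc m)"
      using m by (simp add: r_def sum.atLeast_Suc_atMost)
    have Zi: "Z i (fun_upd \<omega> (Suc m) y) = Z i \<omega>" if "i \<le> m" for i \<omega> y
      unfolding Z_def walk_def using that by (intro arg_cong2[where f=minus] sum.cong refl) auto
    have ZS: "Z (Suc m) (fun_upd \<omega> (Suc m) y) = Z m \<omega> - k * v (Suc m) + sqrt (v (Suc m)) * y" for \<omega> y
    proof -
      have "(\<Sum>j\<le>m. sqrt (v j) * (fun_upd \<omega> (Suc m) y) j) = (\<Sum>j\<le>m. sqrt (v j) * \<omega> j)"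
        by (intro sum.cong) auto
      then show ?thesis by (simp add: Z_def walk_def algebra_simps)
    qed
    have A_Suc: "indicator (A (Suc m)) (fun_upd \<omega> (Suc m) y) = indicator (A m) \<omega> * (indicator {0<..} (Z (Suc m) (fun_upd \<omega> (Suc m) y)) :: real)"
      if "\<omega> \<in> space (stdP m)" for \<omega> y
    proof -
      have "fun_upd \<omega> (Suc m) y \<in> space (stdP (Suc m))"
        using that by (auto simp: space_PiM PiE_iff extensional_def)
      then have "fun_upd \<omega> (Suc m) y \<in> A (Suc m) \<longleftrightarrow> \<omega> \<in> A m \<and> 0 < Z (Suc m) (fun_upd \<omega> (Suc m) y)"
        using that by (auto simp: A_def Zi le_Suc_eq)
      then show ?thesis by (simp add: indicator_def)
    qed
    have "e (Suc m) = (\<integral>\<omega>. (\<integral>y. indicator (A (Suc m)) (fun_upd \<omega> (Suc m) y) * survival k (Z (Suc m) (fun_upd \<omega> (Suc m) y)) (r (Suc m)) \<partial>stdN) \<partial>stdP m)"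
      unfolding e_def ins
      by (rule stdNs.product_integral_insert) (use int_e[of "Suc m"] in \<open>simp_all flip: ins\<close>)
    also have "\<dots> = (\<integral>\<omega>. indicator (A m) \<omega> * (\<integral>y. indicator {0<..} (Z m \<omega> - k * v (Suc m) + sqrt (v (Suc m)) * y)
         * survival k (Z m \<omega> - k * v (Suc m) + sqrt (v (Suc m)) * y) (r (Suc m)) \<partial>stdN) \<partial>stdP m)"
      by (intro Bochner_Integration.integral_cong refl) (simp add: A_Suc ZS mult.assoc)
    also have "\<dots> \<ge> e m"
      unfolding e_def
    proof (rule integral_mono[OF int_e])
      interpret prob_space "stdP m" by (rule prob_space_stdP)
      let ?g = "\<lambda>\<omega> y. indicator {0<..} (Z m \<omega> - k * v (Suc m) + sqrt (v (Suc m)) * y)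
         * survival k (Z m \<omega> - k * v (Suc m) + sqrt (v (Suc m)) * y) (r (Suc m))"
      have g_meas: "(\<lambda>(\<omega>, y). ?g \<omega> y) \<in> borel_measurable (stdP m \<Otimes>\<^sub>M stdN)"
        using Z_meas[of m m] by measurable
      have g_int: "integrable stdN (?g \<omega>)" "\<bar>\<integral>y. ?g \<omega> y \<partial>stdN\<bar> \<le> 1" for \<omega>
        by (intro stdN_integral_bound ind_bound; measurable)+
      show "integrable (stdP m) (\<lambda>\<omega>. indicator (A m) \<omega> * (\<integral>y. ?g \<omega> y \<partial>stdN))"
      proof (rule integrable_const_bound[where B=1])
        show "AE \<omega> in stdP m. norm (indicator (A m) \<omega> * (\<integral>y. ?g \<omega> y \<partial>stdN)) \<le> 1"
          using g_int(2) by (auto simp: indicator_def)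
        have "(\<lambda>\<omega>. \<integral>y. ?g \<omega> y \<partial>stdN) \<in> borel_measurable (stdP m)"
          using g_meas by (rule stdN.borel_measurable_lebesgue_integral)
        then show "(\<lambda>\<omega>. indicator (A m) \<omega> * (\<integral>y. ?g \<omega> y \<partial>stdN)) \<in> borel_measurable (stdP m)"
          by measurable
      qed
      fix \<omega>
      have "survival k (Z m \<omega>) (r m) = (\<integral>y. survival k (Z m \<omega> - k * v (Suc m) + sqrt (v (Suc m)) * y) (r (Suc m)) \<partial>stdN)"
        unfolding r_Suc by (rule survival_semigroup[symmetric]) (use k v r_nonneg in auto)
      also have "\<dots> \<le> (\<integral>y. ?g \<omega> y \<partial>stdN)"
      proof (rule integral_mono)
        show "integrable stdN (\<lambda>y. survival k (Z m \<omega> - k * v (Suc m) + sqrt (v (Suc m)) * y) (r (Suc m)))"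
          by (intro stdN_integral_bound survival_abs_le_1 k) measurable
        show "survival k (Z m \<omega> - k * v (Suc m) + sqrt (v (Suc m)) * y) (r (Suc m)) \<le> ?g \<omega> y" for y
          using survival_nonpos[OF k r_nonneg] by (auto simp: indicator_def not_less)
      qed (rule g_int)
      finally show "indicator (A m) \<omega> * survival k (Z m \<omega>) (r m) \<le> indicator (A m) \<omega> * (\<integral>y. ?g \<omega> y \<partial>stdN)"
        by (auto simp: indicator_def)
    qed
    finally show ?thesis .
  qed
  have "e 0 \<le> e m" if "m \<le> n" for m
    using that by (induction m) (auto intro: order_trans[OF _ step])
  then have "e 0 \<le> e n" by simp
  also have "e n = measure (stdP n) (A n)"
  proof -
    have "e n = (\<integral>\<omega>. indicator (A n) \<omega> \<partial>stdP n)"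
      unfolding e_def
      by (intro Bochner_Integration.integral_cong refl) (auto simp: r_def survival_0 ruin_test_def A_def indicator_def)
    then show ?thesis using sets.sets_into_space[OF A_meas[of n]] by (simp add: Int_absorb2)
  qed
  also have "A n = {\<omega> \<in> space (stdP n). \<forall>i\<in>{..n}. U + k * (\<Sum>j\<in>{1..i}. v j) < walk v i \<omega>}"
    by (auto simp: A_def Z_def algebra_simps)
  also have "e 0 = (\<integral>x. indicator {0<..} (sqrt (v 0) * x - U) * survival k (sqrt (v 0) * x - U) (\<Sum>j\<in>{1..n}. v j) \<partial>stdN)"
  proof -
    have "e 0 = (\<integral>\<omega>. (\<lambda>x. indicator {0<..} (sqrt (v 0) * x - U) * survival k (sqrt (v 0) * x - U) (\<Sum>j\<in>{1..n}. v j)) (\<omega> 0) \<partial>stdP 0)"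
      unfolding e_def
      by (intro Bochner_Integration.integral_cong refl) (auto simp: r_def A_def Z_def walk_def indicator_def)
    also have "\<dots> = (\<integral>x. indicator {0<..} (sqrt (v 0) * x - U) * survival k (sqrt (v 0) * x - U) (\<Sum>j\<in>{1..n}. v j) \<partial>stdN)"
      unfolding atMost_0 by (rule stdNs.product_integral_singleton) measurable
    finally show ?thesis .
  qed
  finally show ?thesis .
qed

section \<open>Gaussian processes with stationary increments\<close>

lemma (in prob_space) gaussian_rv_centered:
  assumes Y: "gaussian_rv M Y" and 0: "expectation Y = 0"
  shows "integrable M (\<lambda>\<omega>. (Y \<omega>)\<^sup>2)"
    and "(\<integral>\<omega>. cis (Y \<omega>) \<partial>M) = of_real (exp (- expectation (\<lambda>\<omega>. (Y \<omega>)\<^sup>2) / 2))"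
proof -
  have [measurable]: "Y \<in> borel_measurable M" using Y by (simp add: gaussian_rv_def)
  consider \<mu> where "AE \<omega> in M. Y \<omega> = \<mu>"
    | \<mu> s where "0 < s" "distributed M lborel Y (\<lambda>x. ennreal (normal_density \<mu> s x))"
    using Y unfolding gaussian_rv_def by blast
  then have "integrable M (\<lambda>\<omega>. (Y \<omega>)\<^sup>2) \<and>
    (\<integral>\<omega>. cis (Y \<omega>) \<partial>M) = of_real (exp (- expectation (\<lambda>\<omega>. (Y \<omega>)\<^sup>2) / 2))"
  proof cases
    case 1
    have "expectation Y = expectation (\<lambda>_. \<mu>)"
      by (intro integral_cong_AE) (use 1 in auto)
    then have "\<mu> = 0" using 0 prob_space by simp
    then have Y0: "AE \<omega> in M. Y \<omega> = 0" using 1 by simp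
    have sq: "integrable M (\<lambda>\<omega>. (Y \<omega>)\<^sup>2) \<longleftrightarrow> integrable M (\<lambda>_. 0::real)"
      by (intro integrable_cong_AE) (use Y0 in auto)
    have "expectation (\<lambda>\<omega>. (Y \<omega>)\<^sup>2) = expectation (\<lambda>_. 0)"
      by (intro integral_cong_AE) (use Y0 in auto)
    moreover have "(\<integral>\<omega>. cis (Y \<omega>) \<partial>M) = (\<integral>\<omega>. 1 \<partial>M)"
      by (intro integral_cong_AE) (use Y0 in auto)
    ultimately show ?thesis using prob_space sq by simp
  next
    case 2
    have \<mu>: "\<mu> = 0" using normal_distributed_expectation[OF 2] 0 by simp
    note D = 2(2)[unfolded \<mu>]
    have sq: "integrable M (\<lambda>\<omega>. (Y \<omega>)\<^sup>2)"
      using distributed_integrable[OF D, of "\<lambda>x. x\<^sup>2"] integrable_normal_moment[OF 2(1), of 0 2] by simp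
    have var: "expectation (\<lambda>\<omega>. (Y \<omega>)\<^sup>2) = s\<^sup>2"
      using normal_distributed_variance[OF 2(1) D] 0 by simp
    have "distributed M lborel (\<lambda>x. (Y x - 0) / s) (\<lambda>x. ennreal (std_normal_density x))"
      using normal_standard_normal_convert[OF 2(1), of Y 0] D by simp
    then have std: "distr M lborel (\<lambda>x. Y x / s) = stdN"
      by (simp add: distributed_def)
    have "(\<integral>\<omega>. cis (Y \<omega>) \<partial>M) = (\<integral>\<omega>. cis (s * (Y \<omega> / s)) \<partial>M)"
      using 2(1) by simp
    also have "\<dots> = (\<integral>y. cis (s * y) \<partial>distr M lborel (\<lambda>x. Y x / s))"
      by (subst integral_distr) auto
    also have "\<dots> = of_real (exp (- s\<^sup>2 / 2))"
      unfolding std using char_stdN[of s] by (simp add: cis_conv_exp)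
    finally show ?thesis using sq var by simp
  qed
  then show "integrable M (\<lambda>\<omega>. (Y \<omega>)\<^sup>2)"
    and "(\<integral>\<omega>. cis (Y \<omega>) \<partial>M) = of_real (exp (- expectation (\<lambda>\<omega>. (Y \<omega>)\<^sup>2) / 2))" by auto
qed

text \<open>Both \<open>s\<close> and \<open>t - s\<close> are convex combinations of 0 and
  \<open>t\<close>; the two chord bounds have weights adding up to 1.\<close>

lemma convex_on_superadditive:
  fixes f :: "real \<Rightarrow> real"
  assumes "convex_on {0..} f" "f 0 = 0" "0 \<le> s" "s \<le> t"
  shows "f s + f (t - s) \<le> f t"
proof (cases "t = 0")
  case True
  then show ?thesis using assms by simp
next
  case False
  then have t: "0 < t" using assms by simp
  have scale: "f (u * t) \<le> u * f t" if "0 \<le> u" "u \<le> 1" for u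
    using convex_onD[OF assms(1), of u 0 t] that assms(2) t by simp
  have "s / t * t = s" "(1 - s / t) * t = t - s"
    using t by (simp_all add: left_diff_distrib)
  then have "f s \<le> s / t * f t" "f (t - s) \<le> (1 - s / t) * f t"
    using scale[of "s / t"] scale[of "1 - s / t"] t assms(3,4) by auto
  then show ?thesis by (simp add: algebra_simps)
qed

locale stationary_gaussian = prob_space M for M :: "'a measure" +
  fixes X :: "real \<Rightarrow> 'a \<Rightarrow> real"
  assumes gauss: "gaussian_process M X" and cent: "centered M X"
    and X_0: "AE \<omega> in M. X 0 \<omega> = 0" and stat: "stationary_increments M X"
begin

abbreviation "V \<equiv> var_fun M X"

lemma X_meas: "0 \<le> t \<Longrightarrow> X t \<in> borel_measurable M"
  using gauss[unfolded gaussian_process_def, rule_format, of "{t}" "\<lambda>_. 1"] by (simp add: gaussian_rv_def)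

lemma X_integrable: "0 \<le> t \<Longrightarrow> integrable M (X t)"
  and X_mean: "0 \<le> t \<Longrightarrow> expectation (X t) = 0"
  using cent by (auto simp: centered_def)

lemma X_sq_integrable: "0 \<le> t \<Longrightarrow> integrable M (\<lambda>\<omega>. (X t \<omega>)\<^sup>2)"
  using gauss[unfolded gaussian_process_def, rule_format, of "{t}" "\<lambda>_. 1"]
  by (intro gaussian_rv_centered) (simp_all add: X_mean)

lemma V_eq: "0 \<le> t \<Longrightarrow> V t = expectation (\<lambda>\<omega>. (X t \<omega>)\<^sup>2)"
  by (simp add: var_fun_def X_mean)

lemma X_mult_integrable:
  assumes "0 \<le> s" "0 \<le> t"
  shows "integrable M (\<lambda>\<omega>. X s \<omega> * X t \<omega>)"
proof (rule Bochner_Integration.integrable_bound)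
  show "integrable M (\<lambda>\<omega>. (X s \<omega>)\<^sup>2 + (X t \<omega>)\<^sup>2)"
    using assms by (intro Bochner_Integration.integrable_add X_sq_integrable)
  show "(\<lambda>\<omega>. X s \<omega> * X t \<omega>) \<in> borel_measurable M"
    using assms by (intro borel_measurable_times X_meas)
  have "\<bar>x * y\<bar> \<le> x\<^sup>2 + y\<^sup>2" for x y :: real
    using sum_squares_bound[of "\<bar>x\<bar>" "\<bar>y\<bar>"] by (simp add: abs_mult)
      (metis abs_ge_zero add_increasing2 mult_nonneg_nonneg order_trans zero_le_power2 le_add_same_cancel1 mult_2 mult.assoc)
  then show "AE \<omega> in M. norm (X s \<omega> * X t \<omega>) \<le> norm ((X s \<omega>)\<^sup>2 + (X t \<omega>)\<^sup>2)"
    by simp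
qed

lemma V_0: "V 0 = 0"
proof -
  have "V 0 = expectation (\<lambda>_. 0)"
    unfolding V_eq[OF order_refl]
    by (intro integral_cong_AE borel_measurable_power X_meas) (use X_0 in auto)
  then show ?thesis by simp
qed

lemma increment_variance:
  assumes "0 \<le> h" "0 \<le> t"
  shows "expectation (\<lambda>\<omega>. (X (h + t) \<omega> - X h \<omega>)\<^sup>2) = V t"
proof -
  note [measurable] = X_meas[OF assms(1)] X_meas[OF assms(2)] X_meas[OF add_nonneg_nonneg[OF assms]] X_meas[OF order_refl]
  let ?P = "PiM {t} (\<lambda>_. borel) :: (real \<Rightarrow> real) measure"
  have eq: "distr M ?P (\<lambda>\<omega>. \<lambda>t\<in>{t}. X (h + t) \<omega> - X h \<omega>) = distr M ?P (\<lambda>\<omega>. \<lambda>t\<in>{t}. X t \<omega> - X 0 \<omega>)"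
    using stat[unfolded stationary_increments_def] assms by simp
  have "expectation (\<lambda>\<omega>. (X (h + t) \<omega> - X h \<omega>)\<^sup>2) = (\<integral>f. (f t)\<^sup>2 \<partial>distr M ?P (\<lambda>\<omega>. \<lambda>t\<in>{t}. X (h + t) \<omega> - X h \<omega>))"
    by (subst integral_distr) (auto intro!: measurable_restrict)
  also have "\<dots> = (\<integral>f. (f t)\<^sup>2 \<partial>distr M ?P (\<lambda>\<omega>. \<lambda>t\<in>{t}. X t \<omega> - X 0 \<omega>))"
    by (simp only: eq)
  also have "\<dots> = expectation (\<lambda>\<omega>. (X t \<omega> - X 0 \<omega>)\<^sup>2)"
    by (subst integral_distr) (auto intro!: measurable_restrict)
  also have "\<dots> = expectation (\<lambda>\<omega>. (X t \<omega>)\<^sup>2)"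
    by (intro integral_cong_AE) (use X_0 in auto)
  finally show ?thesis using assms by (simp add: V_eq)
qed

definition cov :: "real \<Rightarrow> real \<Rightarrow> real" where
  "cov s t = expectation (\<lambda>\<omega>. X s \<omega> * X t \<omega>)"

lemma cov_commute: "cov s t = cov t s"
  by (simp add: cov_def mult.commute)

lemma cov_eq:
  assumes "0 \<le> s" "s \<le> t"
  shows "cov s t = (V s + V t - V (t - s)) / 2"
proof -
  have t: "0 \<le> t" using assms by simp
  have "V (t - s) = expectation (\<lambda>\<omega>. (X t \<omega> - X s \<omega>)\<^sup>2)"
    using increment_variance[of s "t - s"] assms by simp
  also have "\<dots> = expectation (\<lambda>\<omega>. (X t \<omega>)\<^sup>2 + (X s \<omega>)\<^sup>2 - 2 * (X s \<omega> * X t \<omega>))"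
    by (simp add: power2_diff mult_ac)
  also have "\<dots> = V t + V s - 2 * cov s t"
    using assms t by (simp add: V_eq cov_def X_sq_integrable X_mult_integrable)
  finally show ?thesis by simp
qed

text \<open>For s \<le> t, \<open>cov_eq\<close> reduces this to V t - V (t - s) \<ge> V s, the
  superadditivity of \<open>V\<close>.\<close>

lemma cov_ge:
  assumes "convex_on {0..} V" "0 \<le> s" "0 \<le> t"
  shows "V (min s t) \<le> cov s t"
proof -
  have "V s \<le> cov s t" if "0 \<le> s" "s \<le> t" for s t
    using convex_on_superadditive[OF assms(1) V_0 that] cov_eq[OF that] by simp
  from this[of s t] this[of t s] show ?thesis
    using assms by (cases "s \<le> t") (auto simp: cov_commute)
qed

text \<open>Injectivity of \<open>p\<close> lets the sum over indices be rewritten as a sum over a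
  set of times, the form in which \<open>gaussian_process\<close> is stated.\<close>

lemma char_X:
  fixes p :: "nat \<Rightarrow> real"
  assumes p: "inj_on p {..n}" "\<And>i. i \<le> n \<Longrightarrow> 0 \<le> p i"
  shows "(\<integral>\<omega>. cis (\<Sum>i\<le>n. a i * X (p i) \<omega>) \<partial>M)
    = of_real (exp (- (\<Sum>i\<le>n. \<Sum>j\<le>n. a i * a j * cov (p i) (p j)) / 2))"
proof -
  let ?Y = "\<lambda>\<omega>. \<Sum>i\<le>n. a i * X (p i) \<omega>"
  have "?Y = (\<lambda>\<omega>. \<Sum>t\<in>p ` {..n}. a (the_inv_into {..n} p t) * X t \<omega>)"
    using p by (simp add: sum.reindex the_inv_into_f_f)
  moreover have "gaussian_rv M \<dots>"
    using p by (intro gauss[unfolded gaussian_process_def, rule_format] conjI finite_imageI) auto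
  ultimately have g: "gaussian_rv M ?Y" by simp
  have m: "expectation ?Y = 0"
    using p by (subst Bochner_Integration.integral_sum) (auto simp: X_integrable X_mean)
  have "expectation (\<lambda>\<omega>. (?Y \<omega>)\<^sup>2) = expectation (\<lambda>\<omega>. \<Sum>i\<le>n. \<Sum>j\<le>n. a i * a j * (X (p i) \<omega> * X (p j) \<omega>))"
    by (simp add: power2_eq_square sum_product mult_ac)
  also have "\<dots> = (\<Sum>i\<le>n. \<Sum>j\<le>n. a i * a j * cov (p i) (p j))"
  proof -
    have int: "integrable M (\<lambda>\<omega>. a i * a j * (X (p i) \<omega> * X (p j) \<omega>))" if "i \<in> {..n}" "j \<in> {..n}" for i j
      using that p by (intro integrable_mult_right X_mult_integrable) auto
    have "expectation (\<lambda>\<omega>. \<Sum>i\<le>n. \<Sum>j\<le>n. a i * a j * (X (p i) \<omega> * X (p j) \<omega>))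
      = (\<Sum>i\<le>n. expectation (\<lambda>\<omega>. \<Sum>j\<le>n. a i * a j * (X (p i) \<omega> * X (p j) \<omega>)))"
      by (intro Bochner_Integration.integral_sum Bochner_Integration.integrable_sum int)
    also have "\<dots> = (\<Sum>i\<le>n. \<Sum>j\<le>n. expectation (\<lambda>\<omega>. a i * a j * (X (p i) \<omega> * X (p j) \<omega>)))"
      by (intro sum.cong refl Bochner_Integration.integral_sum int)
    finally show ?thesis by (simp add: cov_def)
  qed
  finally show ?thesis using gaussian_rv_centered(2)[OF g m] by simp
qed

lemma grid_bound:
  fixes p :: "nat \<Rightarrow> real"
  assumes k: "0 < k" and conv: "convex_on {0..} V" and mono: "strict_mono_on {0..} V"
    and p: "strict_mono p" "0 \<le> p 0"
  shows "(\<integral>x. indicator {0<..} (sqrt (V (p 0)) * x - U) * survival k (sqrt (V (p 0)) * x - U) (V (p n) - V (p 0)) \<partial>stdN)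
     \<le> prob {\<omega> \<in> space M. \<forall>i\<in>{..n}. U + k * (V (p i) - V (p 0)) \<le> X (p i) \<omega>}"
proof -
  have p_le: "p i \<le> p j" if "i \<le> j" for i j
    using p(1) that by (metis strict_mono_mono monoD)
  have p_pos: "0 \<le> p i" for i
    using p(2) p_le[of 0 i] by simp
  \<comment> \<open>The partial sums telescope to \<open>V (p m)\<close>: the walk is Brownian
    motion with clock \<open>V\<close> read off on the grid.\<close>
  define v where "v j = (case j of 0 \<Rightarrow> V (p 0) | Suc i \<Rightarrow> V (p (Suc i)) - V (p i))" for j
  have V_mono: "V s \<le> V t" if "0 \<le> s" "s \<le> t" for s t
    using strict_mono_on_leD[OF mono] that by simp
  have v_nonneg: "0 \<le> v j" for j
    using V_mono[of 0 "p 0"] V_mono[OF p_pos, of _ "p (Suc _)"] V_0 p_pos[of 0] p_le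
    by (auto simp: v_def split: nat.split)
  have v_sum: "(\<Sum>l\<le>m. v l) = V (p m)" for m
    by (induction m) (simp_all add: v_def)
  have v_sum1: "(\<Sum>l\<in>{1..m}. v l) = V (p m) - V (p 0)" for m
    by (induction m) (simp_all add: v_def)
  have p_min: "p (min i j) = min (p i) (p j)" for i j
    using p_le[of i j] p_le[of j i] by (cases "i \<le> j") (simp_all add: min_absorb1 min_absorb2)
  interpret stdP: prob_space "stdP n" by (rule prob_space_stdP)
  \<comment> \<open>\<open>min i n\<close> only makes the families measurable for indices outside \<open>{..n}\<close>.\<close>
  interpret gaussian_comparison M "stdP n" "{..n}" "\<lambda>i. X (p (min i n))" "\<lambda>i. walk v (min i n)"
    "\<lambda>i j. cov (p i) (p j)" "\<lambda>i j. \<Sum>l\<le>min i j. v l"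
  proof unfold_locales
    show "(\<integral>\<omega>. cis (\<Sum>i\<le>n. a i * X (p (min i n)) \<omega>) \<partial>M)
       = of_real (exp (- (\<Sum>i\<le>n. \<Sum>j\<le>n. a i * a j * cov (p i) (p j)) / 2))" for a
      using char_X[of p n a, OF strict_mono_imp_inj_on[OF p(1)] p_pos] by (simp add: min_absorb1)
    show "(\<integral>\<omega>. cis (\<Sum>i\<le>n. a i * walk v (min i n) \<omega>) \<partial>stdP n)
       = of_real (exp (- (\<Sum>i\<le>n. \<Sum>j\<le>n. a i * a j * (\<Sum>l\<le>min i j. v l)) / 2))" for a
      using char_walk[OF v_nonneg, of n a] by (simp add: min_absorb1)
    show "cov (p i) (p i) = (\<Sum>l\<le>min i i. v l)" for i
      using cov_eq[OF p_pos order_refl] by (simp add: v_sum V_0)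
    show "(\<Sum>l\<le>min i j. v l) \<le> cov (p i) (p j)" for i j
      using cov_ge[OF conv p_pos p_pos] by (simp add: v_sum p_min)
  qed (simp_all add: X_meas p_pos walk_measurable)
  have "(\<integral>x. indicator {0<..} (sqrt (V (p 0)) * x - U) * survival k (sqrt (V (p 0)) * x - U) (V (p n) - V (p 0)) \<partial>stdN)
     \<le> measure (stdP n) {\<omega> \<in> space (stdP n). \<forall>i\<in>{..n}. U + k * (V (p i) - V (p 0)) < walk v (min i n) \<omega>}"
    using walk_stays_above[where v=v and U=U and n=n, OF k v_nonneg] unfolding v_sum1 by (simp add: v_def min_absorb1)
  also have "\<dots> \<le> prob {\<omega> \<in> space M. \<forall>i\<in>{..n}. U + k * (V (p i) - V (p 0)) \<le> X (p (min i n)) \<omega>}"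
    by (rule slepian)
  finally show ?thesis by (simp add: min_absorb1)
qed

end

section \<open>The Parisian ruin event\<close>

text \<open>Over the reals, \<open>INF\<close> and \<open>SUP\<close> are meaningful only on bounded
  sets, which continuity on compact intervals supplies. It also makes the supremum attained, so that
  it stays strictly negative.\<close>

lemma INF_SUP_less_0_iff:
  fixes r :: "real \<Rightarrow> real"
  assumes r: "continuous_on {0..} r" and S: "0 < S" and T: "0 < T"
  shows "(INF t\<in>{0..S}. SUP s\<in>{t..t+T}. r s) < 0 \<longleftrightarrow> (\<exists>t\<in>{0..S}. \<forall>s\<in>{t..t+T}. r s < 0)"
proof -
  have cont: "continuous_on {a..b} r" if "0 \<le> a" for a b
    using r that by (rule_tac continuous_on_subset) auto
  have bdd: "bdd_above (r ` {t..t+T})" if "t \<in> {0..S}" for t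
    using compact_continuous_image[OF cont compact_Icc, of t "t + T"] that
    by (intro bounded_imp_bdd_above compact_imp_bounded) auto
  have "bdd_below (r ` {0..S})"
    using compact_continuous_image[OF cont compact_Icc, of 0 S]
    by (intro bounded_imp_bdd_below compact_imp_bounded) auto
  then have "\<exists>b. \<forall>t\<in>{0..S}. b \<le> r t" by (auto simp: bdd_below_def)
  then obtain b where b: "\<And>t. t \<in> {0..S} \<Longrightarrow> b \<le> r t" by blast
  have bdd_SUP: "bdd_below ((\<lambda>t. SUP s\<in>{t..t+T}. r s) ` {0..S})"
  proof (rule bdd_belowI2)
    fix t assume t: "t \<in> {0..S}"
    have "r t \<le> (SUP s\<in>{t..t+T}. r s)"
      using T by (intro cSUP_upper bdd t) auto
    then show "b \<le> (SUP s\<in>{t..t+T}. r s)" using b[OF t] by linarith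
  qed
  have "(SUP s\<in>{t..t+T}. r s) < 0 \<longleftrightarrow> (\<forall>s\<in>{t..t+T}. r s < 0)" if t: "t \<in> {0..S}" for t
  proof
    assume *: "(SUP s\<in>{t..t+T}. r s) < 0"
    show "\<forall>s\<in>{t..t+T}. r s < 0"
    proof
      fix s assume "s \<in> {t..t+T}"
      then have "r s \<le> (SUP s\<in>{t..t+T}. r s)" by (intro cSUP_upper bdd t)
      then show "r s < 0" using * by linarith
    qed
  next
    assume *: "\<forall>s\<in>{t..t+T}. r s < 0"
    have "continuous_on {t..t+T} r" using t by (intro cont) auto
    then obtain x where x: "x \<in> {t..t+T}" "\<And>y. y \<in> {t..t+T} \<Longrightarrow> r y \<le> r x"
      using continuous_attains_sup[of "{t..t+T}" r] T by auto
    then have "(SUP s\<in>{t..t+T}. r s) \<le> r x"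
      using T by (intro cSUP_least) auto
    then show "(SUP s\<in>{t..t+T}. r s) < 0" using * x(1) by force
  qed
  then show ?thesis
    using S by (subst cINF_less_iff[OF _ bdd_SUP]) auto
qed

text \<open>Serves measurability, by making all quantifiers countable. The margin
  \<open>1 / real (Suc n)\<close> is essential: a path negative at all rationals may vanish at an
  irrational time. Compactness provides the margin, and density of the rationals with continuity
  carries it back to all times.\<close>

lemma ex_interval_neg_iff_rational:
  fixes r :: "real \<Rightarrow> real"
  assumes r: "continuous_on {0..} r" and S: "0 < S" and T: "0 < T"
  shows "(\<exists>t\<in>{0..S}. \<forall>s\<in>{t..t+T}. r s < 0) \<longleftrightarrow>
    (\<exists>t\<in>\<rat> \<inter> {0..S}. \<exists>n::nat. \<forall>s\<in>\<rat> \<inter> {t..t+T}. r s \<le> - 1 / real (Suc n))"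
proof
  assume "\<exists>t\<in>{0..S}. \<forall>s\<in>{t..t+T}. r s < 0"
  then obtain t where t: "t \<in> {0..S}" and neg: "\<And>s. s \<in> {t..t+T} \<Longrightarrow> r s < 0" by auto
  have "continuous_on {t..t+T} r"
    using t by (intro continuous_on_subset[OF r]) auto
  then obtain x where x: "x \<in> {t..t+T}" "\<And>y. y \<in> {t..t+T} \<Longrightarrow> r y \<le> r x"
    using continuous_attains_sup[of "{t..t+T}" r] T by auto
  define m where "m = - r x"
  have m: "0 < m" using neg[OF x(1)] by (simp add: m_def)
  have "uniformly_continuous_on {0..S+T} r"
    by (intro compact_uniformly_continuous continuous_on_subset[OF r]) auto
  then obtain d where d: "0 < d" "\<And>x y. x \<in> {0..S+T} \<Longrightarrow> y \<in> {0..S+T} \<Longrightarrow> dist y x < d \<Longrightarrow> dist (r y) (r x) < m / 2"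
    unfolding uniformly_continuous_on_def using m by (meson half_gt_zero)
  \<comment> \<open>Since \<open>S > 0\<close> this interval is nonempty even at
    \<open>t = 0\<close> and \<open>t = S\<close>; a rational start inside it shifts the window by
    less than \<open>d\<close>.\<close>
  have "max 0 (t - d) < min S (t + d)" using t S d by auto
  then obtain t' where t': "t' \<in> \<rat>" "max 0 (t - d) < t'" "t' < min S (t + d)"
    using Rats_dense_in_real by blast
  obtain n where n: "inverse (real (Suc n)) < m / 2"
    using reals_Archimedean[of "m / 2"] m by auto
  have "r s \<le> - 1 / real (Suc n)" if s: "s \<in> {t'..t'+T}" for s
  proof -
    have y: "s - (t' - t) \<in> {t..t+T}" using s by auto
    have "dist (r s) (r (s - (t' - t))) < m / 2"
      using s t' t y by (intro d(2)) (auto simp: dist_real_def)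
    then have "r s < r (s - (t' - t)) + m / 2" unfolding dist_real_def by linarith
    also have "\<dots> \<le> - (m / 2)" using x(2)[OF y] by (simp add: m_def)
    finally show ?thesis using n by (simp add: inverse_eq_divide)
  qed
  then show "\<exists>t\<in>\<rat> \<inter> {0..S}. \<exists>n::nat. \<forall>s\<in>\<rat> \<inter> {t..t+T}. r s \<le> - 1 / real (Suc n)"
    using t' by (intro bexI[of _ t'] exI[of _ n]) auto
next
  assume "\<exists>t\<in>\<rat> \<inter> {0..S}. \<exists>n::nat. \<forall>s\<in>\<rat> \<inter> {t..t+T}. r s \<le> - 1 / real (Suc n)"
  then obtain t n where t: "t \<in> {0..S}" and le: "\<forall>s\<in>\<rat> \<inter> {t..t+T}. r s \<le> - 1 / real (Suc n)" by blast
  have "r s < 0" if s: "s \<in> {t..t+T}" for s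
  proof (rule ccontr)
    assume "\<not> r s < 0"
    have "continuous_on {t..t+T} r"
      using t by (intro continuous_on_subset[OF r]) auto
    then obtain d where d: "0 < d" "\<And>x. x \<in> {t..t+T} \<Longrightarrow> dist x s < d \<Longrightarrow> dist (r x) (r s) < 1 / real (Suc n)"
      unfolding continuous_on_iff using s by (metis zero_less_divide_1_iff of_nat_0_less_iff zero_less_Suc)
    have "max t (s - d) < min (t + T) (s + d)" using s d T by auto
    then obtain x where x: "x \<in> \<rat>" "max t (s - d) < x" "x < min (t + T) (s + d)"
      using Rats_dense_in_real by blast
    then have "dist (r x) (r s) < 1 / real (Suc n)"
      by (intro d(2)) (auto simp: dist_real_def)
    moreover have "r x \<le> - 1 / real (Suc n)" using x le by auto
    ultimately show False using \<open>\<not> r s < 0\<close> by (simp add: dist_real_def abs_less_iff)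
  qed
  then show "\<exists>t\<in>{0..S}. \<forall>s\<in>{t..t+T}. r s < 0" using t by blast
qed

context stationary_gaussian begin

text \<open>The window starting at \<open>t = S\<close> witnesses ruin on \<open>D\<close>. The ruin
  set agrees almost everywhere with its countable description \<open>G\<close>, so it is measurable
  in the completion and has the probability of \<open>G\<close>.\<close>

lemma parisian_ruin_prob_ge:
  assumes paths: "continuous_paths_AE M X" and S: "0 < S" and T: "0 < T"
    and D: "D \<in> sets M" "AE \<omega> in M. \<omega> \<in> D \<longrightarrow> (\<forall>s\<in>{S..S+T}. u + c * s < X s \<omega>)"
  shows "prob D \<le> parisian_ruin_prob M X c S u T"
proof -
  let ?R = "\<lambda>\<omega> s. risk_process X c u s \<omega>"
  let ?A = "{\<omega> \<in> space M. (INF t\<in>{0..S}. SUP s\<in>{t..t+T}. ?R \<omega> s) < 0}"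
  define G where "G = {\<omega> \<in> space M. \<exists>t\<in>\<rat> \<inter> {0..S}. \<exists>n::nat. \<forall>s\<in>\<rat> \<inter> {t..t+T}. ?R \<omega> s \<le> - 1 / real (Suc n)}"
  have R_meas: "(\<lambda>\<omega>. ?R \<omega> s) \<in> borel_measurable M" if "0 \<le> s" for s
    unfolding risk_process_def using X_meas[OF that] by measurable
  have count: "countable (\<rat> \<inter> A)" for A :: "real set"
    using countable_rat by (rule countable_subset[rotated]) auto
  have G: "G \<in> sets M"
    unfolding G_def
  proof (intro sets.sets_Collect_countable_Ex' sets.sets_Collect_countable_Ex sets.sets_Collect_countable_All' count)
    show "{\<omega> \<in> space M. ?R \<omega> s \<le> - 1 / real (Suc n)} \<in> sets M" if "t \<in> \<rat> \<inter> {0..S}" "s \<in> \<rat> \<inter> {t..t+T}" for t s n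
    proof -
      have "0 \<le> s" using that by auto
      from R_meas[OF this] show ?thesis by measurable
    qed
  qed
  have cont: "AE \<omega> in M. continuous_on {0..} (?R \<omega>)"
    using paths unfolding continuous_paths_AE_def risk_process_def
    by eventually_elim (intro continuous_intros)
  have iff: "AE \<omega> in M. \<omega> \<in> ?A \<longleftrightarrow> (\<omega> \<in> space M \<and> (\<exists>t\<in>{0..S}. \<forall>s\<in>{t..t+T}. ?R \<omega> s < 0))"
    using cont by eventually_elim (simp add: INF_SUP_less_0_iff S T)
  have AG: "AE \<omega> in M. \<omega> \<in> ?A \<longleftrightarrow> \<omega> \<in> G"
    using cont by eventually_elim (simp add: INF_SUP_less_0_iff ex_interval_neg_iff_rational S T G_def)
  have DG: "AE \<omega> in M. \<omega> \<in> D \<longrightarrow> \<omega> \<in> G"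
    using D(2) AG iff
  proof eventually_elim
    case (elim \<omega>)
    show ?case
    proof
      assume "\<omega> \<in> D"
      then have "\<omega> \<in> space M" "\<forall>s\<in>{S..S+T}. ?R \<omega> s < 0"
        using elim(1) sets.sets_into_space[OF D(1)] by (auto simp: risk_process_def)
      then show "\<omega> \<in> G" using elim(2,3) S by auto
    qed
  qed
  have A: "?A \<in> sets (completion M)"
  proof (rule completion.in_sets_AE)
    show "AE \<omega> in completion M. \<omega> \<in> G \<longleftrightarrow> \<omega> \<in> ?A"
      using AE_completion[OF AG] by eventually_elim simp
  qed (use G in auto)
  have "prob D \<le> prob G"
    using DG G by (rule finite_measure_mono_AE)
  also have "\<dots> = measure (completion M) G"
    using G by simp
  also have "\<dots> = measure (completion M) ?A"
    by (rule measure_eq_AE) (use AE_completion[OF AG] A G in auto)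
  finally show ?thesis by (simp add: parisian_ruin_prob_def)
qed

end

section \<open>Survival near the boundary\<close>

text \<open>The product (1 - x + x^2 / 2) (1 + x + x^2 / 2) equals 1 + x^4 / 4, and its second
  factor is at most \<open>exp x\<close>.\<close>

lemma exp_minus_le_quadratic:
  fixes x :: real
  assumes "0 \<le> x"
  shows "exp (- x) \<le> 1 - x + x\<^sup>2 / 2"
proof -
  have pos: "0 \<le> 1 - x + x\<^sup>2 / 2"
    using zero_le_power2[of "x - 1"] by (simp add: power2_diff)
  have "(1 - x + x\<^sup>2 / 2) * (1 + x + x\<^sup>2 / 2) = 1 + (x\<^sup>2)\<^sup>2 / 4"
    by (simp add: power2_eq_square algebra_simps)
  then have "1 \<le> (1 - x + x\<^sup>2 / 2) * (1 + x + x\<^sup>2 / 2)" by simp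
  also have "\<dots> \<le> (1 - x + x\<^sup>2 / 2) * exp x"
    using assms by (intro mult_left_mono pos exp_lower_Taylor_quadratic)
  finally have "exp (- x) * 1 \<le> exp (- x) * ((1 - x + x\<^sup>2 / 2) * exp x)"
    by (intro mult_left_mono) auto
  also have "\<dots> = (1 - x + x\<^sup>2 / 2) * (exp (- x) * exp x)" by (simp only: mult_ac)
  also have "exp (- x) * exp x = 1" by (simp flip: exp_add)
  finally show ?thesis by simp
qed

lemma integrable_normal_density_mult:
  assumes "0 < s"
  shows "integrable lborel (\<lambda>v. indicator {0<..} v * (normal_density m s v * (a * v + b * v\<^sup>2)))"
proof -
  have i2: "integrable lborel (\<lambda>v. normal_density m s v * (v - m)\<^sup>2)"
    using assms by (rule integrable_normal_moment)
  have i1: "integrable lborel (\<lambda>v. normal_density m s v * v)"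
    using assms by (rule integrable_normal_moment_nz_1)
  have i0: "integrable lborel (\<lambda>v. normal_density m s v)"
    using assms by simp
  have "integrable lborel (\<lambda>v. b * (normal_density m s v * (v - m)\<^sup>2) + (a + 2 * b * m) * (normal_density m s v * v) - b * m\<^sup>2 * normal_density m s v)"
    by (intro Bochner_Integration.integrable_add Bochner_Integration.integrable_diff integrable_mult_right i0 i1 i2)
  also have "(\<lambda>v. b * (normal_density m s v * (v - m)\<^sup>2) + (a + 2 * b * m) * (normal_density m s v * v) - b * m\<^sup>2 * normal_density m s v)
     = (\<lambda>v. normal_density m s v * (a * v + b * v\<^sup>2))"
    by (simp add: fun_eq_iff power2_eq_square algebra_simps)
  finally have "integrable lborel (\<lambda>v. normal_density m s v * (a * v + b * v\<^sup>2))" .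
  from integrable_mult_indicator[OF _ this, of "{0<..}"] show ?thesis by simp
qed

text \<open>The vanishing terms give both integrands the shape of \<open>integrable_normal_density_mult\<close>.\<close>

definition survival_slope :: "real \<Rightarrow> real \<Rightarrow> real" where
  "survival_slope k \<Delta> = (\<integral>v. indicator {0<..} v * (normal_density (- k * \<Delta>) (sqrt \<Delta>) v * (2 / \<Delta> * v + 0 * v\<^sup>2)) \<partial>lborel)"

definition survival_curvature :: "real \<Rightarrow> real \<Rightarrow> real" where
  "survival_curvature k \<Delta> = (\<integral>v. indicator {0<..} v * (normal_density (- k * \<Delta>) (sqrt \<Delta>) v * (0 * v + 2 / \<Delta>\<^sup>2 * v\<^sup>2)) \<partial>lborel)"

lemma survival_curvature_nonneg: "0 \<le> survival_curvature k \<Delta>"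
  unfolding survival_curvature_def by (intro integral_nonneg_AE AE_I2) auto

text \<open>In \<open>survival_kernel\<close> put x = 2 v z / \<Delta> and use 1 - exp (- x) \<ge> x
  - x^2 / 2; the two terms integrate to the slope and the curvature. Moving the mean of the density
  from z - k \<Delta> to - k \<Delta> costs only the factor exp (- z^2 / (2 \<Delta>)), since the
  cross term 2 z (v + k \<Delta>) is nonnegative.\<close>

lemma survival_lower_bound:
  assumes k: "0 < k" and \<Delta>: "0 < \<Delta>" and z: "0 \<le> z"
  shows "exp (- z\<^sup>2 / (2 * \<Delta>)) * (survival_slope k \<Delta> * z - survival_curvature k \<Delta> * z\<^sup>2) \<le> survival k z \<Delta>"
proof -
  let ?p = "normal_density (- k * \<Delta>) (sqrt \<Delta>)"
  let ?e = "exp (- z\<^sup>2 / (2 * \<Delta>))"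
  have i: "integrable lborel (\<lambda>v. indicator {0<..} v * (?p v * (a * v + b * v\<^sup>2)))" for a b
    using \<Delta> by (intro integrable_normal_density_mult) simp
  have lin: "?e * (z * (indicator {0<..} v * (?p v * (2 / \<Delta> * v + 0 * v\<^sup>2)))
       - z\<^sup>2 * (indicator {0<..} v * (?p v * (0 * v + 2 / \<Delta>\<^sup>2 * v\<^sup>2))))
     = ?e * (indicator {0<..} v * (?p v * (2 * v * z / \<Delta> - (2 * v * z / \<Delta>)\<^sup>2 / 2)))" for v
    by (simp add: power_mult_distrib power_divide field_simps)
  have "?e * (survival_slope k \<Delta> * z - survival_curvature k \<Delta> * z\<^sup>2)
     = ?e * (z * survival_slope k \<Delta> - z\<^sup>2 * survival_curvature k \<Delta>)" by (simp add: mult.commute)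
  also have "\<dots> = (\<integral>v. ?e * (z * (indicator {0<..} v * (?p v * (2 / \<Delta> * v + 0 * v\<^sup>2)))
       - z\<^sup>2 * (indicator {0<..} v * (?p v * (0 * v + 2 / \<Delta>\<^sup>2 * v\<^sup>2)))) \<partial>lborel)"
    unfolding survival_slope_def survival_curvature_def
    by (subst Bochner_Integration.integral_mult_right_zero, subst Bochner_Integration.integral_diff)
       (intro integrable_mult_right i | simp)+
  also have "\<dots> \<le> (\<integral>v. indicator {0<..} v * (normal_density (z - k * \<Delta>) (sqrt \<Delta>) v * (1 - exp (- 2 * v * z / \<Delta>))) \<partial>lborel)"
  proof (rule integral_mono)
    show "integrable lborel (\<lambda>v. ?e * (z * (indicator {0<..} v * (?p v * (2 / \<Delta> * v + 0 * v\<^sup>2)))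
       - z\<^sup>2 * (indicator {0<..} v * (?p v * (0 * v + 2 / \<Delta>\<^sup>2 * v\<^sup>2)))))"
      by (intro integrable_mult_right Bochner_Integration.integrable_diff i)
    show "integrable lborel (\<lambda>v. indicator {0<..} v * (normal_density (z - k * \<Delta>) (sqrt \<Delta>) v * (1 - exp (- 2 * v * z / \<Delta>))))"
      by (rule survival_kernel(1)[OF k \<Delta>])
    fix v :: real
    show "?e * (z * (indicator {0<..} v * (?p v * (2 / \<Delta> * v + 0 * v\<^sup>2)))
       - z\<^sup>2 * (indicator {0<..} v * (?p v * (0 * v + 2 / \<Delta>\<^sup>2 * v\<^sup>2))))
      \<le> indicator {0<..} v * (normal_density (z - k * \<Delta>) (sqrt \<Delta>) v * (1 - exp (- 2 * v * z / \<Delta>)))"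
    proof (cases "0 < v")
      case True
      let ?x = "2 * v * z / \<Delta>"
      have x: "0 \<le> ?x" using True z \<Delta> by simp
      have "(v - (z - k * \<Delta>))\<^sup>2 = (v - - k * \<Delta>)\<^sup>2 + z\<^sup>2 - 2 * z * (v + k * \<Delta>)"
        by (simp add: power2_eq_square algebra_simps)
      moreover have "0 \<le> 2 * z * (v + k * \<Delta>)" using True z k \<Delta> by simp
      ultimately have "(v - (z - k * \<Delta>))\<^sup>2 \<le> (v - - k * \<Delta>)\<^sup>2 + z\<^sup>2" by linarith
      then have "- ((v - - k * \<Delta>)\<^sup>2 + z\<^sup>2) / (2 * \<Delta>) \<le> - (v - (z - k * \<Delta>))\<^sup>2 / (2 * \<Delta>)"
        using \<Delta> by (intro divide_right_mono) auto
      then have "exp (- z\<^sup>2 / (2 * \<Delta>)) * exp (- (v - - k * \<Delta>)\<^sup>2 / (2 * \<Delta>)) \<le> exp (- (v - (z - k * \<Delta>))\<^sup>2 / (2 * \<Delta>))"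
        unfolding exp_add[symmetric] exp_le_cancel_iff by (simp add: add_divide_distrib diff_divide_distrib)
      then have p: "?e * ?p v \<le> normal_density (z - k * \<Delta>) (sqrt \<Delta>) v"
        using \<Delta> by (simp add: normal_density_def divide_right_mono)
      have "?x - ?x\<^sup>2 / 2 \<le> 1 - exp (- ?x)"
        using exp_minus_le_quadratic[OF x] by simp
      \<comment> \<open>The order matters: \<open>?x - ?x\<^sup>2 / 2\<close> may be negative, so
        the density is enlarged only once the nonnegative \<open>1 - exp (- ?x)\<close> has replaced
        it.\<close>
      then have "(?e * ?p v) * (?x - ?x\<^sup>2 / 2) \<le> (?e * ?p v) * (1 - exp (- ?x))"
        by (intro mult_left_mono) auto
      also have "\<dots> \<le> normal_density (z - k * \<Delta>) (sqrt \<Delta>) v * (1 - exp (- ?x))"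
        using x by (intro mult_right_mono p) auto
      finally show ?thesis unfolding lin using True by (simp add: mult.assoc)
    next
      case False
      then show ?thesis by simp
    qed
  qed
  finally show ?thesis unfolding survival_kernel(2)[OF k \<Delta>] .
qed

text \<open>Positivity of the constant is read off the integral; in \<open>ruin_const\<close> it is
  hidden in a difference of two positive terms.\<close>

lemma survival_slope_pos:
  assumes "0 < \<Delta>"
  shows "0 < survival_slope k \<Delta>"
proof -
  let ?f = "\<lambda>v. indicator {0<..} v * (normal_density (- k * \<Delta>) (sqrt \<Delta>) v * (2 / \<Delta> * v + 0 * v\<^sup>2))"
  have i: "integrable lborel ?f"
    using assms by (intro integrable_normal_density_mult) simp
  have nn: "AE v in lborel. 0 \<le> ?f v"
    using assms by (intro AE_I2) (auto simp: indicator_def)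
  have "survival_slope k \<Delta> \<noteq> 0"
  proof
    assume "survival_slope k \<Delta> = 0"
    then have "AE v in lborel. ?f v = 0"
      using integral_nonneg_eq_0_iff_AE[OF i nn] by (simp add: survival_slope_def)
    \<comment> \<open>Any interval of positive length in the positive half-line would serve.\<close>
    then have "AE v in lborel. v \<notin> {1..2::real}"
    proof eventually_elim
      case (elim v)
      have "normal_density (- k * \<Delta>) (sqrt \<Delta>) v > 0"
        using assms by (intro normal_density_pos) simp
      then show ?case using elim assms by (auto simp: indicator_def)
    qed
    then have "{1..2::real} \<in> null_sets lborel"
      by (subst AE_iff_null_sets) auto
    then have "emeasure lborel {1..2::real} = 0" by (rule null_setsD1)
    then show False by simp
  qed
  moreover have "0 \<le> survival_slope k \<Delta>"
    unfolding survival_slope_def using nn by (rule integral_nonneg_AE)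
  ultimately show ?thesis by simp
qed

section \<open>Normal tail integrals and the closed form of the constant\<close>

lemma std_normal_first_moment_tail:
  assumes "0 \<le> a"
  shows "has_bochner_integral lborel (\<lambda>y. indicator {a..} y * (y * std_normal_density y)) (std_normal_density a)"
proof (rule has_bochner_integral_nn_integral)
  have "((\<lambda>y. - (c * exp (- y\<^sup>2 / 2))) has_real_derivative x * (c * exp (- x\<^sup>2 / 2))) (at x)" for c x :: real
    by (auto intro!: derivative_eq_intros)
  then have "((\<lambda>y. - std_normal_density y) has_real_derivative x * std_normal_density x) (at x)" for x
    unfolding std_normal_density_def .
  moreover have "((\<lambda>y::real. - std_normal_density y) \<longlongrightarrow> 0) at_top"
    unfolding std_normal_density_def by real_asymp
  ultimately have "(\<integral>\<^sup>+y. ennreal (y * std_normal_density y) * indicator {a..} y \<partial>lborel) = ennreal (0 - - std_normal_density a)"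
    using assms by (intro nn_integral_FTC_atLeast) auto
  then show "(\<integral>\<^sup>+y. ennreal (indicator {a..} y * (y * std_normal_density y)) \<partial>lborel) = ennreal (std_normal_density a)"
    by (simp add: mult.commute ennreal_mult' ennreal_indicator)
qed (use assms in \<open>auto simp: indicator_def\<close>)

lemma normal_tail_integral:
  shows "has_bochner_integral lborel (\<lambda>y. indicator {a..} y * std_normal_density y) (normal_tail a)"
proof -
  have "normal_tail a = (\<integral>y. indicator {a<..} y \<partial>stdN)"
    unfolding normal_tail_def by simp
  also have "\<dots> = (\<integral>y. std_normal_density y * indicator {a<..} y \<partial>lborel)"
    by (subst integral_density) auto
  also have "\<dots> = (\<integral>y. indicator {a..} y * std_normal_density y \<partial>lborel)"
    by (intro integral_cong_AE eventually_mono[OF AE_lborel_singleton[of a]]) (auto simp: indicator_def)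
  finally show ?thesis
    using integrable_mult_indicator[of "{a..}" lborel std_normal_density]
    by (simp add: has_bochner_integral_iff)
qed

text \<open>With v = - k \<Delta> + sqrt \<Delta> y the integral becomes (2 / sqrt \<Delta>) times
  the integral of (y - a) against the standard normal density over y > a = k sqrt \<Delta>. The
  first moment of the tail gives the density at a, and the rest gives a times the tail.\<close>

lemma survival_slope_eq_ruin_const:
  assumes "0 < c" "0 < v'" "0 < \<Delta>"
  shows "survival_slope (c / v') \<Delta> = ruin_const c \<Delta> v'"
proof -
  define k where "k = c / v'"
  have k: "0 < k" using assms by (simp add: k_def)
  define a where "a = k * sqrt \<Delta>"
  have a: "0 \<le> a" using k assms(3) by (simp add: a_def)
  have sq: "sqrt \<Delta> * sqrt \<Delta> = \<Delta>" using assms by simp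
  have aff: "std_normal_density y = sqrt \<Delta> * normal_density (- k * \<Delta>) (sqrt \<Delta>) (- k * \<Delta> + sqrt \<Delta> * y)" for y
    using assms by (simp add: normal_density_def std_normal_density_def real_sqrt_mult power_mult_distrib)
  have iff: "0 < - k * \<Delta> + sqrt \<Delta> * y \<longleftrightarrow> a < y" for y
  proof -
    have "- k * \<Delta> + sqrt \<Delta> * y = sqrt \<Delta> * (y - a)"
      unfolding a_def using sq by (simp add: algebra_simps)
    then show ?thesis using assms by (simp add: zero_less_mult_iff)
  qed
  have "survival_slope k \<Delta> = sqrt \<Delta> * (\<integral>y. indicator {0<..} (- k * \<Delta> + sqrt \<Delta> * y) * (normal_density (- k * \<Delta>) (sqrt \<Delta>) (- k * \<Delta> + sqrt \<Delta> * y) * (2 / \<Delta> * (- k * \<Delta> + sqrt \<Delta> * y))) \<partial>lborel)"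
    unfolding survival_slope_def using assms
    by (subst lborel_integral_real_affine[of "sqrt \<Delta>" _ "- k * \<Delta>"]) auto
  also have "\<dots> = (\<integral>y. sqrt \<Delta> * (indicator {0<..} (- k * \<Delta> + sqrt \<Delta> * y) * (normal_density (- k * \<Delta>) (sqrt \<Delta>) (- k * \<Delta> + sqrt \<Delta> * y) * (2 / \<Delta> * (- k * \<Delta> + sqrt \<Delta> * y)))) \<partial>lborel)"
    by simp
  also have "\<dots> = (\<integral>y. indicator {a..} y * (y * std_normal_density y) * (2 / sqrt \<Delta>) - indicator {a..} y * std_normal_density y * (2 * k) \<partial>lborel)"
  proof (intro integral_cong_AE eventually_mono[OF AE_lborel_singleton[of a]])
    fix y assume "y \<noteq> a"
    have e: "2 / \<Delta> * (- k * \<Delta> + sqrt \<Delta> * y) = 2 / sqrt \<Delta> * y - 2 * k"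
      using assms sq by (simp add: field_simps)
    show "sqrt \<Delta> * (indicator {0<..} (- k * \<Delta> + sqrt \<Delta> * y) * (normal_density (- k * \<Delta>) (sqrt \<Delta>) (- k * \<Delta> + sqrt \<Delta> * y) * (2 / \<Delta> * (- k * \<Delta> + sqrt \<Delta> * y))))
      = indicator {a..} y * (y * std_normal_density y) * (2 / sqrt \<Delta>) - indicator {a..} y * std_normal_density y * (2 * k)"
      using iff[of y] \<open>y \<noteq> a\<close> unfolding e aff by (auto simp: indicator_def algebra_simps)
  qed auto
  also have "\<dots> = std_normal_density a * (2 / sqrt \<Delta>) - normal_tail a * (2 * k)"
    by (intro has_bochner_integral_integral_eq has_bochner_integral_diff has_bochner_integral_mult_left
        std_normal_first_moment_tail[OF a] normal_tail_integral)
  finally show ?thesis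
    unfolding ruin_const_def k_def[symmetric] by (simp add: a_def k_def mult_ac)
qed

text \<open>Mills' bound, from x \<le> y under the integral. An upper bound is the right direction,
  because the tail stands in the denominator of the final quotient.\<close>

lemma normal_tail_le:
  assumes "0 < x"
  shows "x * normal_tail x \<le> std_normal_density x"
proof -
  have "(\<integral>y. x * (indicator {x..} y * std_normal_density y) \<partial>lborel) \<le> (\<integral>y. indicator {x..} y * (y * std_normal_density y) \<partial>lborel)"
    using normal_tail_integral[of x] std_normal_first_moment_tail[of x] assms
    by (intro integral_mono) (auto simp: has_bochner_integral_iff indicator_def mult_right_mono)
  then show ?thesis
    using has_bochner_integral_integral_eq[OF normal_tail_integral[of x]]
      has_bochner_integral_integral_eq[OF std_normal_first_moment_tail[of x]] assms by simp
qed

lemma normal_tail_pos: "0 < normal_tail x"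
proof -
  have "normal_tail x \<noteq> 0"
  proof
    assume "normal_tail x = 0"
    then have "AE y in lborel. indicator {x..} y * std_normal_density y = 0"
      using normal_tail_integral[of x] integral_nonneg_eq_0_iff_AE[of lborel "\<lambda>y. indicator {x..} y * std_normal_density y"]
      by (simp add: has_bochner_integral_iff)
    then have "AE y in lborel. y \<notin> {x..x + 1}"
    proof eventually_elim
      case (elim y)
      have "std_normal_density y > 0" by (intro normal_density_pos) simp
      then show ?case using elim by (auto simp: indicator_def)
    qed
    then have "{x..x + 1} \<in> null_sets lborel"
      by (subst AE_iff_null_sets) auto
    then have "emeasure lborel {x..x + 1} = 0" by (rule null_setsD1)
    then show False by simp
  qed
  then show ?thesis by (simp add: normal_tail_def order_less_le)
qed

section \<open>Integration over the overshoot\<close>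

lemma has_bochner_integral_power_exp:
  fixes b :: real
  assumes "0 < b"
  shows "has_bochner_integral lborel (\<lambda>w. indicator {0..} w * (w ^ n * exp (- b * w))) (fact n / b ^ Suc n)"
proof -
  have "has_bochner_integral lborel (\<lambda>x. indicator {0..} x * (x ^ n * exp (- x))) (fact n :: real)"
  proof (rule has_bochner_integral_nn_integral)
    show "(\<integral>\<^sup>+x. ennreal (indicator {0..} x * (x ^ n * exp (- x))) \<partial>lborel) = ennreal (fact n)"
      using nn_intergal_power_times_exp_Ici[of n]
      by (simp add: mult.commute ennreal_mult' ennreal_indicator)
  qed (auto simp: indicator_def)
  then have "has_bochner_integral lborel (\<lambda>x. indicator {0..} (0 + b * x) * ((0 + b * x) ^ n * exp (- (0 + b * x)))) (fact n /\<^sub>R \<bar>b\<bar>)"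
    using assms by (subst (asm) lborel_has_bochner_integral_real_affine_iff[of b _ _ 0]) auto
  then have "has_bochner_integral lborel (\<lambda>x. (1 / b ^ n) * (indicator {0..} (0 + b * x) * ((0 + b * x) ^ n * exp (- (0 + b * x))))) ((1 / b ^ n) * (fact n /\<^sub>R \<bar>b\<bar>))"
    by (intro has_bochner_integral_mult_right)
  moreover have "(1 / b ^ n) * (indicator {0..} (0 + b * x) * ((0 + b * x) ^ n * exp (- (0 + b * x)))) = indicator {0..} x * (x ^ n * exp (- b * x))" for x
    using assms by (auto simp: indicator_def power_mult_distrib zero_le_mult_iff)
  moreover have "(1 / b ^ n) * (fact n /\<^sub>R \<bar>b\<bar>) = fact n / b ^ Suc n"
    using assms by (simp add: field_simps)
  ultimately show ?thesis by simp
qed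

text \<open>The probability that Brownian motion exceeds \<open>U\<close> at time
  \<open>\<sigma>\<^sup>2\<close> and then stays above the line of slope \<open>k\<close> starting
  at \<open>U\<close> for a time \<Delta>; \<open>w\<close> is the overshoot.\<close>

definition survival_bound :: "real \<Rightarrow> real \<Rightarrow> real \<Rightarrow> real \<Rightarrow> real" where
  "survival_bound k \<sigma> \<Delta> U = (\<integral>w. indicator {0<..} w * (survival k w \<Delta> * normal_density 0 \<sigma> (U + w)) \<partial>lborel)"

lemma integrable_survival_bound:
  assumes "0 < k" "0 < \<sigma>"
  shows "integrable lborel (\<lambda>w. indicator {0<..} w * (survival k w \<Delta> * normal_density 0 \<sigma> (U + w)))"
proof (rule Bochner_Integration.integrable_bound)
  show "integrable lborel (\<lambda>w. normal_density 0 \<sigma> (U + 1 * w))"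
    using assms by (intro lborel_integrable_real_affine) auto
  have "\<bar>survival k w \<Delta>\<bar> * normal_density 0 \<sigma> (U + w) \<le> 1 * normal_density 0 \<sigma> (U + w)" for w
    by (intro mult_right_mono survival_abs_le_1 assms) auto
  then show "AE w in lborel. norm (indicator {0<..} w * (survival k w \<Delta> * normal_density 0 \<sigma> (U + w))) \<le> norm (normal_density 0 \<sigma> (U + 1 * w))"
    by (intro AE_I2) (auto simp: indicator_def abs_mult)
qed measurable

lemma survival_bound_eq:
  assumes "0 < \<sigma>"
  shows "(\<integral>x. indicator {0<..} (\<sigma> * x - U) * survival k (\<sigma> * x - U) \<Delta> \<partial>stdN) = survival_bound k \<sigma> \<Delta> U"
proof -
  have aff: "std_normal_density x = \<sigma> * normal_density 0 \<sigma> (U + (- U + \<sigma> * x))" for x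
    using assms by (simp add: normal_density_def std_normal_density_def real_sqrt_mult power_mult_distrib)
  have "(\<integral>x. indicator {0<..} (\<sigma> * x - U) * survival k (\<sigma> * x - U) \<Delta> \<partial>stdN)
     = (\<integral>x. std_normal_density x * (indicator {0<..} (- U + \<sigma> * x) * survival k (- U + \<sigma> * x) \<Delta>) \<partial>lborel)"
    by (subst integral_density) (auto simp: algebra_simps)
  also have "\<dots> = \<bar>\<sigma>\<bar> * (\<integral>x. indicator {0<..} (- U + \<sigma> * x) * (survival k (- U + \<sigma> * x) \<Delta> * normal_density 0 \<sigma> (U + (- U + \<sigma> * x))) \<partial>lborel)"
    unfolding aff integral_mult_right_zero[symmetric] using assms by (intro Bochner_Integration.integral_cong refl) simp
  also have "\<dots> = survival_bound k \<sigma> \<Delta> U"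
    unfolding survival_bound_def using assms
    by (subst lborel_integral_real_affine[of \<sigma> _ "- U"]) auto
  finally show ?thesis .
qed

text \<open>The density at \<open>U + w\<close> is the one at \<open>U\<close> times exp (- b w) exp
  (- w^2 / (2 \<sigma>^2)), so the overshoot is nearly exponential with rate \<open>b\<close>. The
  constant \<open>a\<close> collects this Gaussian factor and the one of
  \<open>survival_lower_bound\<close>. The powers w, w^2, w^3 integrate to 1 / b^2, 2 / b^3, 6 /
  b^4, and the first dominates as \<open>b\<close> grows.\<close>

lemma survival_bound_lower_bound:
  assumes k: "0 < k" and \<Delta>: "0 < \<Delta>" and \<sigma>: "0 < \<sigma>" and U: "0 < U"
  defines "b \<equiv> U / \<sigma>\<^sup>2" and "a \<equiv> 1 / (2 * \<Delta>) + 1 / (2 * \<sigma>\<^sup>2)"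
  shows "normal_density 0 \<sigma> U * (survival_slope k \<Delta> / b ^ 2 - 2 * survival_curvature k \<Delta> / b ^ 3 - 6 * survival_slope k \<Delta> * a / b ^ 4) \<le> survival_bound k \<sigma> \<Delta> U"
proof -
  let ?C = "survival_slope k \<Delta>" and ?K = "survival_curvature k \<Delta>" and ?n = "normal_density 0 \<sigma>"
  have b: "0 < b" using U \<sigma> by (simp add: b_def)
  have a: "0 < a" using \<Delta> \<sigma> by (simp add: a_def add_pos_pos)
  have C: "0 < ?C" by (rule survival_slope_pos[OF \<Delta>])
  define g where "g n w = indicator {0..} w * (w ^ n * exp (- b * w))" for n and w :: real
  have g: "has_bochner_integral lborel (g n) (fact n / b ^ Suc n)" for n
    unfolding g_def by (rule has_bochner_integral_power_exp[OF b])
  have "has_bochner_integral lborel (\<lambda>w. ?n U * (?C * g 1 w - ?K * g 2 w - ?C * a * g 3 w))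
     (?n U * (?C * (fact 1 / b ^ Suc 1) - ?K * (fact 2 / b ^ Suc 2) - ?C * a * (fact 3 / b ^ Suc 3)))"
    by (intro has_bochner_integral_mult_right has_bochner_integral_diff g)
  also have "?n U * (?C * (fact 1 / b ^ Suc 1) - ?K * (fact 2 / b ^ Suc 2) - ?C * a * (fact 3 / b ^ Suc 3))
     = ?n U * (?C / b ^ 2 - 2 * ?K / b ^ 3 - 6 * ?C * a / b ^ 4)"
    by (simp add: eval_nat_numeral mult_ac)
  finally have h: "has_bochner_integral lborel (\<lambda>w. ?n U * (?C * g 1 w - ?K * g 2 w - ?C * a * g 3 w)) \<dots>" .
  have "(\<integral>w. ?n U * (?C * g 1 w - ?K * g 2 w - ?C * a * g 3 w) \<partial>lborel) \<le> survival_bound k \<sigma> \<Delta> U"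
    unfolding survival_bound_def
  proof (rule integral_mono)
    show "integrable lborel (\<lambda>w. ?n U * (?C * g 1 w - ?K * g 2 w - ?C * a * g 3 w))"
      using h by (rule integrable.intros)
    show "integrable lborel (\<lambda>w. indicator {0<..} w * (survival k w \<Delta> * ?n (U + w)))"
      by (rule integrable_survival_bound[OF k \<sigma>])
    fix w :: real
    show "?n U * (?C * g 1 w - ?K * g 2 w - ?C * a * g 3 w) \<le> indicator {0<..} w * (survival k w \<Delta> * ?n (U + w))"
    proof (cases "0 < w")
      case True
      let ?e = "exp (- w\<^sup>2 / (2 * \<Delta>))" and ?f = "exp (- w\<^sup>2 / (2 * \<sigma>\<^sup>2))"
      have "(U + w)\<^sup>2 / (2 * \<sigma>\<^sup>2) = U\<^sup>2 / (2 * \<sigma>\<^sup>2) + b * w + w\<^sup>2 / (2 * \<sigma>\<^sup>2)"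
        using \<sigma> by (simp add: b_def power2_eq_square field_simps)
      then have "exp (- (U + w)\<^sup>2 / (2 * \<sigma>\<^sup>2)) = exp (- U\<^sup>2 / (2 * \<sigma>\<^sup>2)) * exp (- b * w) * ?f"
        unfolding exp_add[symmetric] by simp
      then have nUw: "?n (U + w) = ?n U * exp (- b * w) * ?f"
        by (simp add: normal_density_def)
      have ef: "?e * ?f = exp (- a * w\<^sup>2)"
        unfolding exp_add[symmetric] a_def using \<Delta> \<sigma> by (simp add: field_simps)
      have "1 - a * w\<^sup>2 \<le> ?e * ?f"
        using exp_ge_add_one_self[of "- a * w\<^sup>2"] unfolding ef by simp
      moreover have "?e * ?f \<le> 1" unfolding ef using a by simp
      \<comment> \<open>The Gaussian factor is bounded below in the slope term and above by 1 in the
        subtracted curvature term.\<close>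
      ultimately have "?C * w * (1 - a * w\<^sup>2) - ?K * w\<^sup>2 * 1 \<le> ?C * w * (?e * ?f) - ?K * w\<^sup>2 * (?e * ?f)"
        using C survival_curvature_nonneg[of k \<Delta>] True by (intro diff_mono mult_left_mono) auto
      also have "\<dots> = (?e * (?C * w - ?K * w\<^sup>2)) * ?f" by (simp add: algebra_simps)
      also have "\<dots> \<le> survival k w \<Delta> * ?f"
        using True by (intro mult_right_mono survival_lower_bound[OF k \<Delta>]) auto
      finally have "?n U * exp (- b * w) * (?C * w * (1 - a * w\<^sup>2) - ?K * w\<^sup>2 * 1) \<le> ?n U * exp (- b * w) * (survival k w \<Delta> * ?f)"
        by (intro mult_left_mono) auto
      then show ?thesis
        unfolding nUw g_def using True by (simp add: algebra_simps eval_nat_numeral)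
    next
      case False
      then show ?thesis by (cases "w = 0") (auto simp: g_def)
    qed
  qed
  then show ?thesis
    unfolding has_bochner_integral_integral_eq[OF h] .
qed

text \<open>Removes the slack in the level. For positive \<open>w\<close> and nonnegative
  \<open>U\<close> raising the level lowers the density, so the integrand without slack
  dominates.\<close>

lemma survival_bound_continuous_seq:
  assumes k: "0 < k" and \<Delta>: "0 < \<Delta>" and \<sigma>: "0 < \<sigma>" and U: "0 \<le> U"
  shows "(\<lambda>n. survival_bound k \<sigma> \<Delta> (U + 1 / real (Suc n))) \<longlonglongrightarrow> survival_bound k \<sigma> \<Delta> U"
  unfolding survival_bound_def
proof (rule integral_dominated_convergence[where w="\<lambda>w. indicator {0<..} w * (survival k w \<Delta> * normal_density 0 \<sigma> (U + w))"])
  show "integrable lborel (\<lambda>w. indicator {0<..} w * (survival k w \<Delta> * normal_density 0 \<sigma> (U + w)))"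
    by (rule integrable_survival_bound[OF k \<sigma>])
  show "AE w in lborel. (\<lambda>n. indicator {0<..} w * (survival k w \<Delta> * normal_density 0 \<sigma> (U + 1 / real (Suc n) + w)))
     \<longlonglongrightarrow> indicator {0<..} w * (survival k w \<Delta> * normal_density 0 \<sigma> (U + w))"
  proof (rule AE_I2)
    fix w :: real
    have "(\<lambda>n. 1 / real (Suc n)) \<longlonglongrightarrow> 0"
      using LIMSEQ_inverse_real_of_nat unfolding inverse_eq_divide .
    then have "(\<lambda>n. U + 1 / real (Suc n) + w) \<longlonglongrightarrow> U + 0 + w"
      by (intro tendsto_add tendsto_const)
    moreover have "isCont (normal_density 0 \<sigma>) (U + 0 + w)"
      unfolding normal_density_def using \<sigma> by (intro continuous_intros) auto
    ultimately have "(\<lambda>n. normal_density 0 \<sigma> (U + 1 / real (Suc n) + w)) \<longlonglongrightarrow> normal_density 0 \<sigma> (U + 0 + w)"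
      by (rule isCont_tendsto_compose[rotated])
    then show "(\<lambda>n. indicator {0<..} w * (survival k w \<Delta> * normal_density 0 \<sigma> (U + 1 / real (Suc n) + w)))
     \<longlonglongrightarrow> indicator {0<..} w * (survival k w \<Delta> * normal_density 0 \<sigma> (U + w))"
      by (intro tendsto_mult tendsto_const) simp
  qed
  show "AE w in lborel. norm (indicator {0<..} w * (survival k w \<Delta> * normal_density 0 \<sigma> (U + 1 / real (Suc n) + w)))
     \<le> indicator {0<..} w * (survival k w \<Delta> * normal_density 0 \<sigma> (U + w))" for n
  proof (rule AE_I2)
    fix w :: real
    have "normal_density 0 \<sigma> (U + 1 / real (Suc n) + w) \<le> normal_density 0 \<sigma> (U + w)" if "0 < w"
    proof -
      have "(U + w)\<^sup>2 \<le> (U + 1 / real (Suc n) + w)\<^sup>2"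
        using U that by (intro power_mono) auto
      then show ?thesis
        using \<sigma> by (simp add: normal_density_def divide_right_mono)
    qed
    then show "norm (indicator {0<..} w * (survival k w \<Delta> * normal_density 0 \<sigma> (U + 1 / real (Suc n) + w)))
     \<le> indicator {0<..} w * (survival k w \<Delta> * normal_density 0 \<sigma> (U + w))"
      using survival_nonneg[OF k less_imp_le[OF \<Delta>], of w]
      by (auto simp: indicator_def abs_mult intro!: mult_left_mono)
  qed
qed measurable

section \<open>The lower bound for the ruin probability\<close>

context stationary_gaussian begin

text \<open>On nested dyadic grids the events \<open>D n\<close> decrease, and continuity of the
  path and of \<open>V\<close> extends their intersection to the whole window. Each has at least the
  probability given by \<open>survival_bound\<close>, which depends on the grid only through its end
  points.\<close>

lemma parisian_ruin_prob_ge_survival_bound: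
  assumes paths: "continuous_paths_AE M X" and mono: "strict_mono_on {0..} V" and conv: "convex_on {0..} V"
    and deriv: "(V has_real_derivative v') (at S within {0..})" and contV: "continuous_on {0..} V"
    and c: "0 < c" and v': "0 < v'" and S: "0 < S" and T: "0 < T" and u: "0 \<le> u"
  shows "survival_bound (c / v') (sqrt (V S)) (V (S + T) - V S) (u + c * S) \<le> parisian_ruin_prob M X c S u T"
proof -
  define k where "k = c / v'"
  have k: "0 < k" using c v' by (simp add: k_def)
  have VS: "0 < V S" using strict_mono_onD[OF mono, of 0 S] S V_0 by simp
  \<comment> \<open>The graph of \<open>V\<close> lies above its tangent at \<open>S\<close>;
    multiplying by \<open>k\<close> turns the slope \<open>v'\<close> into \<open>c\<close>.\<close>
  have V_ge: "c * (s - S) \<le> k * (V s - V S)" if "0 \<le> s" for s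
  proof -
    have "v' * (s - S) \<le> V s - V S"
      using S that by (intro convex_on_imp_above_tangent[OF conv _ _ _ deriv]) auto
    then have "k * (v' * (s - S)) \<le> k * (V s - V S)" using k by (intro mult_left_mono) auto
    then show ?thesis using v' by (simp add: k_def mult.assoc[symmetric])
  qed
  define p where "p n i = S + real i * (T / 2 ^ n)" for n i :: nat
  have p_mono: "strict_mono (p n)" for n
  proof (rule strict_monoI)
    fix i j :: nat assume "i < j"
    then have "real i * (T / 2 ^ n) < real j * (T / 2 ^ n)"
      using T by (intro mult_strict_right_mono) auto
    then show "p n i < p n j" by (simp add: p_def)
  qed
  have p_0: "p n 0 = S" and p_last: "p n (2 ^ n) = S + T" for n
    by (simp_all add: p_def)
  have p_pos: "0 \<le> p n i" for n i using S T by (simp add: p_def)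
  \<comment> \<open>The limit over grids yields weak inequalities only; raising the level by \<eta>
    makes those for ruin strict.\<close>
  have ge: "survival_bound k (sqrt (V S)) (V (S + T) - V S) (u + c * S + \<eta>) \<le> parisian_ruin_prob M X c S u T" if \<eta>: "0 < \<eta>" for \<eta>
  proof -
    let ?U = "u + c * S + \<eta>"
    define D where "D n = {\<omega> \<in> space M. \<forall>i\<in>{..2 ^ n}. ?U + k * (V (p n i) - V S) \<le> X (p n i) \<omega>}" for n :: nat
    have D_meas: "D n \<in> sets M" for n
      unfolding D_def
    proof (intro sets.sets_Collect_finite_All)
      show "{\<omega> \<in> space M. ?U + k * (V (p n i) - V S) \<le> X (p n i) \<omega>} \<in> sets M" for i
        using X_meas[OF p_pos[of n i]] by measurable
    qed simp
    have "decseq D"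
    proof (rule decseq_SucI)
      fix n
      have "p n i = p (Suc n) (2 * i)" for i by (simp add: p_def)
      then show "D (Suc n) \<subseteq> D n" by (auto simp: D_def)
    qed
    then have "(\<lambda>n. prob (D n)) \<longlonglongrightarrow> prob (\<Inter>n. D n)"
      using D_meas by (intro finite_Lim_measure_decseq) auto
    moreover have "survival_bound k (sqrt (V S)) (V (S + T) - V S) ?U \<le> prob (D n)" for n
      using grid_bound[OF k conv mono p_mono[of n] p_pos[of n 0], of ?U "2 ^ n"] VS
      unfolding D_def p_0 p_last by (simp add: survival_bound_eq)
    ultimately have "survival_bound k (sqrt (V S)) (V (S + T) - V S) ?U \<le> prob (\<Inter>n. D n)"
      by (intro LIMSEQ_le_const[of "\<lambda>n. prob (D n)"]) auto
    also have "\<dots> \<le> parisian_ruin_prob M X c S u T"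
    proof (rule parisian_ruin_prob_ge[OF paths S T])
      show "(\<Inter>n. D n) \<in> sets M" using D_meas by auto
      show "AE \<omega> in M. \<omega> \<in> (\<Inter>n. D n) \<longrightarrow> (\<forall>s\<in>{S..S+T}. u + c * s < X s \<omega>)"
        using paths unfolding continuous_paths_AE_def
      proof eventually_elim
        case (elim \<omega>)
        show ?case
        proof (intro impI ballI)
          fix s assume D: "\<omega> \<in> (\<Inter>n. D n)" and s: "s \<in> {S..S+T}"
          define f where "f t = X t \<omega> - ?U - k * (V t - V S)" for t
          have f_cont: "continuous_on {0..} f"
            unfolding f_def by (intro continuous_intros elim contV)
          \<comment> \<open>The grid point \<open>p n (i n)\<close> is the left neighbour of
            \<open>s\<close> in the grid of mesh \<open>T / 2 ^ n\<close>.\<close>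
          define i where "i n = nat \<lfloor>(s - S) * 2 ^ n / T\<rfloor>" for n :: nat
          have x0: "0 \<le> (s - S) * 2 ^ n / T" for n using s T by simp
          have i_le: "real (i n) \<le> (s - S) * 2 ^ n / T" and i_ge: "(s - S) * 2 ^ n / T < real (i n) + 1" for n
            using x0[of n] unfolding i_def by linarith+
          have i_bound: "i n \<le> 2 ^ n" for n
          proof -
            have "(s - S) * 2 ^ n / T \<le> 2 ^ n" using s T by (simp add: divide_le_eq)
            then have "real (i n) \<le> 2 ^ n" using i_le[of n] by linarith
            then show ?thesis by (metis of_nat_le_iff of_nat_numeral of_nat_power)
          qed
          have p_close: "p n (i n) \<le> s" "s \<le> p n (i n) + T / 2 ^ n" for n
          proof -
            have "real (i n) * (T / 2 ^ n) \<le> (s - S) * 2 ^ n / T * (T / 2 ^ n)"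
              using T by (intro mult_right_mono i_le) auto
            then show "p n (i n) \<le> s" using T by (simp add: p_def)
            have "(s - S) * 2 ^ n / T * (T / 2 ^ n) \<le> (real (i n) + 1) * (T / 2 ^ n)"
              using T by (intro mult_right_mono less_imp_le[OF i_ge]) auto
            then show "s \<le> p n (i n) + T / 2 ^ n" using T by (simp add: p_def distrib_right add_divide_distrib)
          qed
          have lim0: "(\<lambda>n. s - T / 2 ^ n) \<longlonglongrightarrow> s - 0"
            by (intro tendsto_diff tendsto_const LIMSEQ_divide_realpow_zero) simp
          have "(\<lambda>n. p n (i n)) \<longlonglongrightarrow> s"
          proof (rule tendsto_sandwich[OF _ _ lim0[simplified] tendsto_const])
            show "\<forall>\<^sub>F n in sequentially. s - T / 2 ^ n \<le> p n (i n)"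
              using p_close(2) by (intro always_eventually allI) (simp add: algebra_simps)
            show "\<forall>\<^sub>F n in sequentially. p n (i n) \<le> s"
              using p_close(1) by (intro always_eventually allI)
          qed
          then have "(\<lambda>n. f (p n (i n))) \<longlonglongrightarrow> f s"
            using s S p_pos by (intro continuous_on_tendsto_compose[OF f_cont]) auto
          moreover have "0 \<le> f (p n (i n))" for n
          proof -
            have "\<omega> \<in> D n" using D by blast
            then have "?U + k * (V (p n (i n)) - V S) \<le> X (p n (i n)) \<omega>"
              using i_bound[of n] by (simp add: D_def)
            then show ?thesis by (simp add: f_def)
          qed
          ultimately have "0 \<le> f s"
            by (intro LIMSEQ_le_const[of "\<lambda>n. f (p n (i n))"]) auto
          then show "u + c * s < X s \<omega>"
            using V_ge[of s] \<eta> s S by (simp add: f_def algebra_simps)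
        qed
      qed
    qed
    finally show ?thesis .
  qed
  have "(\<lambda>n. survival_bound k (sqrt (V S)) (V (S + T) - V S) (u + c * S + 1 / real (Suc n)))
     \<longlonglongrightarrow> survival_bound k (sqrt (V S)) (V (S + T) - V S) (u + c * S)"
    using strict_mono_onD[OF mono, of S "S + T"] S T k VS c u by (intro survival_bound_continuous_seq) auto
  then show ?thesis
    unfolding k_def[symmetric] by (rule LIMSEQ_le_const2) (use ge in \<open>auto simp del: of_nat_Suc\<close>)
qed

end

theorem theorem3p1:
  fixes M :: "'a measure"
    and X :: "real \<Rightarrow> 'a \<Rightarrow> real"
    and V' :: "real \<Rightarrow> real"
    and c S T :: real
  assumes "prob_space M"
    and "gaussian_process M X"
    and "centered M X"
    and "continuous_paths_AE M X"
    and "AE \<omega> in M. X 0 \<omega> = 0"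
    and "stationary_increments M X"
    and "\<And>t. t \<ge> 0 \<Longrightarrow> (var_fun M X has_real_derivative V' t) (at t within {0..})"
    and "strict_mono_on {0..} (var_fun M X)"
    and "convex_on {0..} (var_fun M X)"
    and "c > 0" and "S > 0" and "T > 0"
  shows "asymp_ge
    (\<lambda>u. parisian_ruin_prob M X c S u T)
    (\<lambda>u. ruin_const c (var_fun M X (S + T) - var_fun M X S) (V' S)
          * (var_fun M X S / u)
          * normal_tail ((u + c * S) / sqrt (var_fun M X S)))"
proof -
  interpret prob_space M by fact
  interpret stationary_gaussian M X
    by unfold_locales fact+
  define \<Delta> where "\<Delta> = V (S + T) - V S"
  define \<sigma> where "\<sigma> = sqrt (V S)"
  define k where "k = c / V' S"
  define C where "C = ruin_const c \<Delta> (V' S)"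
  have V0S: "V 0 < V S" and V_ST: "V S < V (S + T)"
    using strict_mono_onD[OF assms(8)] assms(11,12) by auto
  \<comment> \<open>The tangent at \<open>S\<close>, evaluated at 0, gives V' S * S \<ge> V S - V 0
    > 0.\<close>
  have V'_pos: "0 < V' S"
  proof -
    have "V' S * (0 - S) \<le> V 0 - V S"
      using assms(11) by (intro convex_on_imp_above_tangent[OF assms(9) _ _ _ assms(7)]) auto
    then have "0 < V' S * S" using V0S by simp
    then show ?thesis using assms(11) by (simp add: zero_less_mult_iff)
  qed
  have \<Delta>: "0 < \<Delta>" and \<sigma>: "0 < \<sigma>" and k: "0 < k" and \<sigma>2: "\<sigma>\<^sup>2 = V S"
    using V_ST V0S V_0 V'_pos assms(10) by (auto simp: \<Delta>_def \<sigma>_def k_def)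
  have C_eq: "survival_slope k \<Delta> = C"
    unfolding k_def C_def by (rule survival_slope_eq_ruin_const) (use assms V'_pos \<Delta> in auto)
  have C: "0 < C" using survival_slope_pos[OF \<Delta>] unfolding C_eq[symmetric] .
  have contV: "continuous_on {0..} V"
    using assms(7) by (intro DERIV_continuous_on[of "{0..}" V V']) auto
  define K where "K = 2 * survival_curvature k \<Delta> / C"
  define a where "a = 6 * (1 / (2 * \<Delta>) + 1 / (2 * \<sigma>\<^sup>2))"
  \<comment> \<open>The lower bound of \<open>survival_bound_lower_bound\<close> divided by the
    claimed asymptotics with the tail replaced by Mills' bound; with U = u + c S one has 1 / b^2 =
    \<sigma>^4 / U^2, and \<open>K\<close> and \<open>a\<close> are the remaining coefficients
    relative to \<open>C\<close>.\<close>
  define g where "g u = u / (u + c * S) * (1 - K * \<sigma>\<^sup>2 / (u + c * S) - a * \<sigma> ^ 4 / (u + c * S)\<^sup>2)" for u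
  have g_lim: "(g \<longlongrightarrow> 1) at_top"
    unfolding g_def by real_asymp
  \<comment> \<open>Positivity of \<open>g u\<close> is what allows Mills' bound to be multiplied by
    it; it holds eventually because \<open>g\<close> tends to 1.\<close>
  have bound: "g u \<le> parisian_ruin_prob M X c S u T / (C * (V S / u) * normal_tail ((u + c * S) / \<sigma>))"
    if u: "0 < u" and gu: "0 < g u" for u
  proof -
    define U where "U = u + c * S"
    have U: "0 < U" using u assms(10,11) by (simp add: U_def add_pos_pos)
    let ?n = "normal_density 0 \<sigma> U" and ?t = "normal_tail (U / \<sigma>)"
    have n: "0 < ?n" using \<sigma> by (rule normal_density_pos)
    have "std_normal_density (U / \<sigma>) = \<sigma> * ?n"
      using \<sigma> by (simp add: normal_density_def std_normal_density_def real_sqrt_mult power_divide)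
    then have t: "?t \<le> \<sigma>\<^sup>2 / U * ?n"
      using normal_tail_le[of "U / \<sigma>"] U \<sigma> by (simp add: field_simps power2_eq_square)
    have t_pos: "0 < ?t" by (rule normal_tail_pos)
    have "g u * (C * (\<sigma>\<^sup>2 / u) * ?t) \<le> g u * (C * (\<sigma>\<^sup>2 / u) * (\<sigma>\<^sup>2 / U * ?n))"
      using gu C u by (intro mult_left_mono t) auto
    also have "\<dots> = ?n * (survival_slope k \<Delta> / (U / \<sigma>\<^sup>2) ^ 2 - 2 * survival_curvature k \<Delta> / (U / \<sigma>\<^sup>2) ^ 3
        - 6 * survival_slope k \<Delta> * (1 / (2 * \<Delta>) + 1 / (2 * \<sigma>\<^sup>2)) / (U / \<sigma>\<^sup>2) ^ 4)"
    proof -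
      have KC: "2 * survival_curvature k \<Delta> = K * C" using C by (simp add: K_def)
      have aC: "6 * C * (1 / (2 * \<Delta>) + 1 / (2 * \<sigma>\<^sup>2)) = a * C" by (simp add: a_def)
      show ?thesis
        unfolding C_eq aC KC g_def U_def[symmetric] using U u \<sigma>
        by (simp add: field_simps eval_nat_numeral)
    qed
    also have "\<dots> \<le> survival_bound k \<sigma> \<Delta> U"
      by (rule survival_bound_lower_bound[OF k \<Delta> \<sigma> U])
    also have "\<dots> \<le> parisian_ruin_prob M X c S u T"
      unfolding k_def \<sigma>_def \<Delta>_def U_def
      by (rule parisian_ruin_prob_ge_survival_bound[OF assms(4,8,9) assms(7) contV assms(10) V'_pos assms(11,12)])
         (use u assms(11) in auto)
    finally have "g u * (C * (V S / u) * ?t) \<le> parisian_ruin_prob M X c S u T"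
      by (simp only: \<sigma>2)
    moreover have "0 < C * (V S / u) * ?t"
      using C u t_pos V0S V_0 by simp
    ultimately show ?thesis
      unfolding U_def by (intro iffD2[OF pos_le_divide_eq])
  qed
  have "1 = Liminf at_top (\<lambda>u. ereal (g u))"
    using lim_imp_Liminf[OF _ tendsto_ereal[OF g_lim]] by (simp add: one_ereal_def)
  also have "\<dots> \<le> Liminf at_top (\<lambda>u. ereal (parisian_ruin_prob M X c S u T / (C * (V S / u) * normal_tail ((u + c * S) / \<sigma>))))"
  proof (rule Liminf_mono)
    show "\<forall>\<^sub>F u in at_top. ereal (g u) \<le> ereal (parisian_ruin_prob M X c S u T / (C * (V S / u) * normal_tail ((u + c * S) / \<sigma>)))"
      using eventually_gt_at_top[of 0] order_tendstoD(1)[OF g_lim zero_less_one]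
      by eventually_elim (intro iffD2[OF ereal_less_eq(3)] bound)
  qed
  finally show ?thesis
    unfolding asymp_ge_def C_def \<Delta>_def \<sigma>_def .
qed

end
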